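(* Let $(X,A_1,\dots,A_n)$ satisfy condition $( * )$ and suppose $X$ is simply connected. Let $p:X\to X/(A_1,\dots,A_n)$ be the quotient map, $a\in\bigcup_{i=1}^nA_i$ and $*=p(a)$. Then $\pi_1^{top}(X/(A_1,\dots,A_n),* )$ is an indiscrete topological group (its only open sets are the empty set and the whole group).
   Context: $X/(A_1,\dots,A_n)$ denotes the quotient space of $X$ by the equivalence relation generated by identifying all points of $A_i$ with each other for each $i$, with quotient map $p$. $\pi_1^{top}(Y,y)$ is $\pi_1(Y,y)$ with the quotient topology with respect to the canonical surjection from the loop space $\Omega(Y,y)$ (based loops with the compact-open topology). Condition $( * )$ on $(X,A_1,\dots,A_n)$ means one of: (i) $X$ is path connected and the $A_i$ are open subsets of $X$ whose closures are path connected; or (ii) $X$ is connected, locally path connected and first countable, and each $A_i$ is an open or closed subset of $X$, the closures $\overline{A_i}$ being path connected and pairwise disjoint. *)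

theory Defs
  imports "HOL-Analysis.Analysis"
begin

definition quotient_topology :: "'a topology \<Rightarrow> ('a \<Rightarrow> 'b) \<Rightarrow> 'b topology" where
  "quotient_topology X f =
     topology (\<lambda>U. U \<subseteq> f ` topspace X \<and> openin X {x \<in> topspace X. f x \<in> U})"

definition collapse_rel :: "'a topology \<Rightarrow> nat \<Rightarrow> (nat \<Rightarrow> 'a set) \<Rightarrow> ('a \<times> 'a) set" where
  "collapse_rel X n A =
     ({(x, y). x \<in> topspace X \<and> y \<in> topspace X \<and>
               (x = y \<or> (\<exists>i<n. x \<in> A i \<and> y \<in> A i))})\<^sup>*"

definition collapse_map :: "'a topology \<Rightarrow> nat \<Rightarrow> (nat \<Rightarrow> 'a set) \<Rightarrow> 'a \<Rightarrow> 'a set" where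
  "collapse_map X n A x = {y. (x, y) \<in> collapse_rel X n A}"

definition collapse_space :: "'a topology \<Rightarrow> nat \<Rightarrow> (nat \<Rightarrow> 'a set) \<Rightarrow> 'a set topology" where
  "collapse_space X n A = quotient_topology X (collapse_map X n A)"

definition loops :: "'b topology \<Rightarrow> 'b \<Rightarrow> (real \<Rightarrow> 'b) set" where
  "loops Y y = {g. pathin Y g \<and> g 0 = y \<and> g 1 = y}"

definition loop_space :: "'b topology \<Rightarrow> 'b \<Rightarrow> (real \<Rightarrow> 'b) topology" where
  "loop_space Y y = topology_generated_by
     {{g \<in> loops Y y. g ` K \<subseteq> U} | K U.
        compactin (subtopology euclideanreal {0..1}) K \<and> openin Y U}"

definition loop_homotopic :: "'b topology \<Rightarrow> 'b \<Rightarrow> (real \<Rightarrow> 'b) \<Rightarrow> (real \<Rightarrow> 'b) \<Rightarrow> bool" where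
  "loop_homotopic Y y f g \<longleftrightarrow>
     homotopic_with (\<lambda>h. h 0 = y \<and> h 1 = y) (subtopology euclideanreal {0..1}) Y f g"

definition loop_class :: "'b topology \<Rightarrow> 'b \<Rightarrow> (real \<Rightarrow> 'b) \<Rightarrow> (real \<Rightarrow> 'b) set" where
  "loop_class Y y f = {g \<in> loops Y y. loop_homotopic Y y f g}"

definition pi1_top :: "'b topology \<Rightarrow> 'b \<Rightarrow> (real \<Rightarrow> 'b) set topology" where
  "pi1_top Y y = quotient_topology (loop_space Y y) (loop_class Y y)"

definition simply_connected_space :: "'a topology \<Rightarrow> bool" where
  "simply_connected_space X \<longleftrightarrow> path_connected_space X \<and>
     (\<forall>x \<in> topspace X. \<forall>g \<in> loops X x. loop_homotopic X x g (\<lambda>t. x))"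

definition condition_star :: "'a topology \<Rightarrow> nat \<Rightarrow> (nat \<Rightarrow> 'a set) \<Rightarrow> bool" where
  "condition_star X n A \<longleftrightarrow>
     (path_connected_space X \<and>
        (\<forall>i<n. openin X (A i) \<and> path_connectedin X (X closure_of A i)))
   \<or> (connected_space X \<and> locally_path_connected_space X \<and> first_countable X \<and>
        (\<forall>i<n. (openin X (A i) \<or> closedin X (A i)) \<and> path_connectedin X (X closure_of A i)) \<and>
        (\<forall>i<n. \<forall>j<n. i \<noteq> j \<longrightarrow> (X closure_of A i) \<inter> (X closure_of A j) = {}))"

end

theory Submission
  imports Defs
begin

text \<open>Images of loops of the simply connected \<open>X\<close> are null-homotopic, so it suffices, after a translation,
  that every loop of the quotient \<open>Y\<close> is approximated by loops that lift to \<open>X\<close> up to homotopy. Near a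
  closed collapsed point, a path is pushed into the collapsed set inside a path component of an open
  set. In the closure of an open point \<open>y\<close>, all paths with the same end points are homotopic, so
  excursions there can be replaced by the constant path \<open>y\<close> and lifted through the path connected
  closure of the collapsed set. By compactness of the interval finitely many such modifications
  suffice.\<close>

section \<open>Homotopies of paths in abstract topologies\<close>

text \<open>A loop of the quotient may pass through collapsed points infinitely often, with
  excursions whose lifts start and end anywhere in the collapsed sets, so it need not lift, nor is a
  homotopy to a lifting loop at hand. Approximation remains possible: finitely many parameters are
  kept, and between them the loop is replaced by short detours whose lifts join chosen
  representatives. Lifting up to homotopy gives the needed freedom: the lift may wander through the
  whole closure of a fibre, and its image may leave the prescribed neighbourhood, while a homotopic
  path stays inside.

  An open set of \<open>pi1_top\<close> corresponds to an open set of loops that is closed under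
  homotopy, and the translation is a concatenation of loops inside such a set. Both alternatives of
  the condition are treated at once by dividing the collapsed sets into open and closed ones.
  Homotopies live on arbitrary intervals, so that pieces glue without rescaling.\<close>

definition path_homotopic :: "real \<Rightarrow> real \<Rightarrow> 'b topology \<Rightarrow> (real \<Rightarrow> 'b) \<Rightarrow> (real \<Rightarrow> 'b) \<Rightarrow> bool" where
  "path_homotopic u v Y f g \<longleftrightarrow>
     homotopic_with (\<lambda>k. k u = f u \<and> k v = f v) (top_of_set {u..v}) Y f g"

lemma path_homotopic_iff:
  fixes Y :: "'b topology"
  assumes "u \<le> v"
  shows "path_homotopic u v Y f g \<longleftrightarrow>
    (\<exists>H :: real \<times> real \<Rightarrow> 'b. continuous_map (top_of_set ({0..1::real} \<times> {u..v})) Y H \<and>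
      (\<forall>s\<in>{u..v}. H (0, s) = f s) \<and> (\<forall>s\<in>{u..v}. H (1, s) = g s) \<and>
      (\<forall>r\<in>{0..1}. H (r, u) = f u \<and> H (r, v) = f v))"
proof -
  have "prod_topology (top_of_set {0..1::real}) (top_of_set {u..v}) = top_of_set ({0..1::real} \<times> {u..v})"
    by (simp flip: subtopology_Times)
  then show ?thesis
    unfolding path_homotopic_def using assms
    by (subst homotopic_with) auto
qed

lemma path_homotopicI:
  assumes "u \<le> v" "continuous_map (top_of_set ({0..1::real} \<times> {u..v})) Y H"
    "\<And>s. s \<in> {u..v} \<Longrightarrow> H (0, s) = f s" "\<And>s. s \<in> {u..v} \<Longrightarrow> H (1, s) = g s"
    "\<And>r. r \<in> {0..1} \<Longrightarrow> H (r, u) = f u" "\<And>r. r \<in> {0..1} \<Longrightarrow> H (r, v) = f v"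
  shows "path_homotopic u v Y f g"
  unfolding path_homotopic_iff[OF assms(1)] by (intro exI[of _ H] conjI ballI assms)

lemma path_homotopic_continuous:
  assumes "path_homotopic u v Y f g"
  shows "continuous_map (top_of_set {u..v}) Y f" "continuous_map (top_of_set {u..v}) Y g"
  using homotopic_with_imp_continuous_maps[OF assms[unfolded path_homotopic_def]] by simp_all

lemma path_homotopic_ends:
  assumes "path_homotopic u v Y f g"
  shows "g u = f u" "g v = f v"
proof -
  have "(\<lambda>k. k u = f u \<and> k v = f v) f \<and> (\<lambda>k. k u = f u \<and> k v = f v) g"
    using assms unfolding path_homotopic_def by (rule homotopic_with_imp_property)
  then show "g u = f u" "g v = f v" by blast+
qed

lemma path_homotopic_refl:
  "continuous_map (top_of_set {u..v}) Y f \<Longrightarrow> path_homotopic u v Y f f"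
  by (simp add: path_homotopic_def)

lemma path_homotopic_sym:
  assumes "path_homotopic u v Y f g" shows "path_homotopic u v Y g f"
  using assms unfolding path_homotopic_def path_homotopic_ends[OF assms]
  by (rule homotopic_with_symD)

lemma path_homotopic_trans:
  assumes "path_homotopic u v Y f g" "path_homotopic u v Y g h"
  shows "path_homotopic u v Y f h"
  using assms unfolding path_homotopic_def path_homotopic_ends[OF assms(1)]
  by (rule homotopic_with_trans)

lemma path_homotopic_cong:
  assumes "path_homotopic u v Y f g" "u \<le> v"
    "\<And>s. s \<in> {u..v} \<Longrightarrow> f' s = f s" "\<And>s. s \<in> {u..v} \<Longrightarrow> g' s = g s"
  shows "path_homotopic u v Y f' g'"
  using assms by (simp add: path_homotopic_iff)

lemma loop_homotopic_iff_path_homotopic: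
  assumes "f 0 = y" "f 1 = y"
  shows "loop_homotopic Y y f g \<longleftrightarrow> path_homotopic 0 1 Y f g"
  using assms by (simp add: loop_homotopic_def path_homotopic_def)

lemma continuous_map_join:
  fixes u v w :: real
  assumes "continuous_map (top_of_set {u..v}) Y f" "continuous_map (top_of_set {v..w}) Y g" "f v = g v"
  shows "continuous_map (top_of_set {u..w}) Y (\<lambda>s. if s \<le> v then f s else g s)"
proof (rule continuous_map_cases_le)
  show "continuous_map (subtopology (top_of_set {u..w}) {x \<in> topspace (top_of_set {u..w}). x \<le> v}) Y f"
    using assms by (auto simp: subtopology_subtopology intro!: continuous_map_from_subtopology_mono[OF assms(1)])
  show "continuous_map (subtopology (top_of_set {u..w}) {x \<in> topspace (top_of_set {u..w}). v \<le> x}) Y g"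
    using assms by (auto simp: subtopology_subtopology intro!: continuous_map_from_subtopology_mono[OF assms(2)])
qed (use assms in \<open>auto simp: continuous_map_id\<close>)

lemma path_homotopic_join:
  assumes "path_homotopic u v Y f f'" "path_homotopic v w Y g g'" "f v = g v" "u \<le> v" "v \<le> w"
  shows "path_homotopic u w Y (\<lambda>s. if s \<le> v then f s else g s) (\<lambda>s. if s \<le> v then f' s else g' s)"
proof -
  obtain H where H: "continuous_map (top_of_set ({0..1::real} \<times> {u..v})) Y H"
      "\<forall>s\<in>{u..v}. H (0, s) = f s" "\<forall>s\<in>{u..v}. H (1, s) = f' s"
      "\<forall>r\<in>{0..1}. H (r, u) = f u \<and> H (r, v) = f v"
    using assms(1) unfolding path_homotopic_iff[OF assms(4)] by blast
  obtain K where K: "continuous_map (top_of_set ({0..1::real} \<times> {v..w})) Y K"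
      "\<forall>s\<in>{v..w}. K (0, s) = g s" "\<forall>s\<in>{v..w}. K (1, s) = g' s"
      "\<forall>r\<in>{0..1}. K (r, v) = g v \<and> K (r, w) = g w"
    using assms(2) unfolding path_homotopic_iff[OF assms(5)] by blast
  show ?thesis
  proof (rule path_homotopicI[where H="\<lambda>x. if snd x \<le> v then H x else K x"])
    let ?X = "top_of_set ({0..1::real} \<times> {u..w})"
    show "continuous_map ?X Y (\<lambda>x. if snd x \<le> v then H x else K x)"
    proof (rule continuous_map_cases_le)
      show "continuous_map ?X euclideanreal snd"
        by (simp add: continuous_on_snd[OF continuous_on_id])
      show "continuous_map (subtopology ?X {x \<in> topspace ?X. snd x \<le> v}) Y H"
        using assms by (auto simp: subtopology_subtopology intro!: continuous_map_from_subtopology_mono[OF H(1)])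
      show "continuous_map (subtopology ?X {x \<in> topspace ?X. v \<le> snd x}) Y K"
        using assms by (auto simp: subtopology_subtopology intro!: continuous_map_from_subtopology_mono[OF K(1)])
      show "H x = K x" if "x \<in> topspace ?X" "snd x = v" for x
        using that H(4) K(4) assms by (cases x) auto
    qed auto
    show "(if snd (r, w) \<le> v then H (r, w) else K (r, w)) = (if w \<le> v then f w else g w)"
      if "r \<in> {0..1}" for r
      using that H(4) K(4) assms by (cases "w = v") auto
    show "(if snd (0, s) \<le> v then H (0, s) else K (0, s)) = (if s \<le> v then f s else g s)"
      "(if snd (1, s) \<le> v then H (1, s) else K (1, s)) = (if s \<le> v then f' s else g' s)"
      if "s \<in> {u..w}" for s
      using that H(2,3) K(2,3) by simp_all
    show "(if snd (r, u) \<le> v then H (r, u) else K (r, u)) = (if u \<le> v then f u else g u)"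
      if "r \<in> {0..1}" for r
      using that H(4) assms(4) by simp
  qed (use assms(4,5) in simp)
qed

lemma path_homotopic_compose_left:
  assumes "path_homotopic u v X f g" "continuous_map X Y p"
  shows "path_homotopic u v Y (p \<circ> f) (p \<circ> g)"
  using assms(1) unfolding path_homotopic_def
  by (rule homotopic_with_compose_continuous_map_left) (use assms(2) in auto)

text \<open>Letting each end of the new interval go to either end of the old one covers reversed
  paths as well as rescaled ones.\<close>

lemma path_homotopic_compose_right:
  assumes "path_homotopic u v Y f g" "continuous_on {u'..v'} \<phi>" "\<phi> ` {u'..v'} \<subseteq> {u..v}"
    "\<phi> u' \<in> {u, v}" "\<phi> v' \<in> {u, v}"
  shows "path_homotopic u' v' Y (f \<circ> \<phi>) (g \<circ> \<phi>)"
  using assms(1) unfolding path_homotopic_def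
  by (rule homotopic_with_compose_continuous_map_right) (use assms in auto)

text \<open>The straight-line homotopy between the two parameter maps stays in \<open>{u..v}\<close>
  by convexity, and \<open>f\<close> carries it to \<open>Y\<close>. It is also what contracts a
  reversed path followed by the path.\<close>

lemma path_homotopic_reparametrize:
  fixes \<phi> \<psi> :: "real \<Rightarrow> real"
  assumes f: "continuous_map (top_of_set {u..v}) Y f"
    and \<phi>: "continuous_on {u'..v'} \<phi>" "\<phi> ` {u'..v'} \<subseteq> {u..v}"
    and \<psi>: "continuous_on {u'..v'} \<psi>" "\<psi> ` {u'..v'} \<subseteq> {u..v}"
    and eq: "\<phi> u' = \<psi> u'" "\<phi> v' = \<psi> v'" and "u' \<le> v'"
  shows "path_homotopic u' v' Y (f \<circ> \<phi>) (f \<circ> \<psi>)"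
proof (rule path_homotopicI[where H="f \<circ> (\<lambda>(r, s). (1 - r) * \<phi> s + r * \<psi> s)"])
  show "continuous_map (top_of_set ({0..1::real} \<times> {u'..v'})) Y (f \<circ> (\<lambda>(r, s). (1 - r) * \<phi> s + r * \<psi> s))"
  proof (rule continuous_map_compose[OF _ f])
    have "continuous_on ({0..1::real} \<times> {u'..v'}) (\<lambda>x. \<phi> (snd x))" "continuous_on ({0..1::real} \<times> {u'..v'}) (\<lambda>x. \<psi> (snd x))"
      by (auto intro!: continuous_on_compose2[OF \<phi>(1)] continuous_on_compose2[OF \<psi>(1)] continuous_intros)
    then have "continuous_on ({0..1::real} \<times> {u'..v'}) (\<lambda>(r, s). (1 - r) * \<phi> s + r * \<psi> s)"
      unfolding case_prod_beta by (intro continuous_intros)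
    moreover have "(1 - r) * \<phi> s + r * \<psi> s \<in> {u..v}" if "r \<in> {0..1}" "s \<in> {u'..v'}" for r s
    proof -
      have "\<phi> s \<in> {u..v}" "\<psi> s \<in> {u..v}"
        using \<phi>(2) \<psi>(2) that(2) by blast+
      with that(1) show ?thesis
        using convexD_alt[of "{u..v}" "\<phi> s" "\<psi> s" r] by simp
    qed
    ultimately show "continuous_map (top_of_set ({0..1::real} \<times> {u'..v'})) (top_of_set {u..v})
      (\<lambda>(r, s). (1 - r) * \<phi> s + r * \<psi> s)"
      by auto
  qed
qed (use eq \<open>u' \<le> v'\<close> in \<open>simp_all add: algebra_simps\<close>)

text \<open>Every open set that meets the closure of \<open>{y}\<close> contains \<open>y\<close>. A
  homotopy may therefore be given by \<open>f\<close> and \<open>g\<close> on the boundary of the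
  square and jump to the constant \<open>y\<close> in the interior.\<close>

lemma path_homotopic_closure_of_singleton:
  assumes f: "continuous_map (top_of_set {u..v}) Y f" "f ` {u..v} \<subseteq> Y closure_of {y}"
    and g: "continuous_map (top_of_set {u..v}) Y g" "g ` {u..v} \<subseteq> Y closure_of {y}"
    and eq: "f u = g u" "f v = g v" and "u \<le> v" and y: "y \<in> topspace Y"
  shows "path_homotopic u v Y f g"
proof -
  define H where "H = (\<lambda>(r::real, s). if r = 0 \<or> s = u \<or> s = v then f s else if r = 1 then g s else y)"
  have "continuous_map (top_of_set ({0..1::real} \<times> {u..v})) Y H"
    unfolding continuous_map
  proof (intro conjI allI impI)
    have "f s \<in> topspace Y" "g s \<in> topspace Y" if "s \<in> {u..v}" for s
      using that f g by (auto simp: continuous_map_def)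
    then show "H ` topspace (top_of_set ({0..1::real} \<times> {u..v})) \<subseteq> topspace Y"
      by (auto simp: H_def y)
    fix V assume V: "openin Y V"
    let ?S = "{0..1} \<times> {u..v}"
    let ?P = "{x \<in> topspace (top_of_set ?S). H x \<in> V}"
    show "openin (top_of_set ?S) ?P"
    proof (cases "y \<in> V")
      case False
      then have "V \<inter> Y closure_of {y} = {}"
        using V by (auto simp: in_closure_of)
      then have "?P = {}"
        using f g y False closure_of_subset[of "{y}" Y] by (fastforce simp: H_def)
      then show ?thesis by (metis openin_empty)
    next
      case True
      have cl: "closed {s \<in> {u..v}. k s \<notin> V}" if "continuous_map (top_of_set {u..v}) Y k" for k
      proof -
        have "closedin (top_of_set {u..v}) {s \<in> topspace (top_of_set {u..v}). k s \<in> topspace Y - V}"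
          using closedin_continuous_map_preimage[OF that closedin_diff[OF closedin_topspace V]] by simp
        moreover have "{s \<in> topspace (top_of_set {u..v}). k s \<in> topspace Y - V} = {s \<in> {u..v}. k s \<notin> V}"
          using that by (auto simp: continuous_map_def)
        ultimately show ?thesis
          by (simp add: closedin_closed_eq)
      qed
      let ?F = "{s \<in> {u..v}. f s \<notin> V}" and ?G = "{s \<in> {u..v}. g s \<notin> V}"
      \<comment> \<open>Since \<open>y\<close> lies in \<open>V\<close>, only boundary points can be
        sent outside \<open>V\<close>; on each side these form a closed set.\<close>
      have "?S - ?P = {0} \<times> ?F \<union> {1} \<times> ?G \<union> {0..1} \<times> (?F \<inter> {u, v})"
        using True eq \<open>u \<le> v\<close> by (auto simp: H_def split: if_splits)
      moreover have "closed \<dots>"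
        using cl[OF f(1)] cl[OF g(1)] by (intro closed_Un closed_Times closed_Int) auto
      ultimately have "closedin (top_of_set ?S) (?S - ?P)"
        by (auto intro: closed_subset)
      then show ?thesis
        by (subst openin_closedin_eq) auto
    qed
  qed
  then show ?thesis
    by (rule path_homotopicI[OF \<open>u \<le> v\<close>]) (use eq \<open>u \<le> v\<close> in \<open>auto simp: H_def\<close>)
qed

section \<open>Quotients and loop spaces\<close>

lemma openin_quotient_topology:
  "openin (quotient_topology X f) U \<longleftrightarrow>
     U \<subseteq> f ` topspace X \<and> openin X {x \<in> topspace X. f x \<in> U}"
proof -
  let ?L = "\<lambda>U. U \<subseteq> f ` topspace X \<and> openin X {x \<in> topspace X. f x \<in> U}"
  have "istopology ?L"
    unfolding istopology_def
  proof (intro conjI allI impI)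
    fix S T assume "?L S" "?L T"
    then show "S \<inter> T \<subseteq> f ` topspace X" "openin X {x \<in> topspace X. f x \<in> S \<inter> T}"
      using openin_Int[of X "{x \<in> topspace X. f x \<in> S}" "{x \<in> topspace X. f x \<in> T}"]
      by (auto simp: Int_def conj_ac elim!: back_subst[where P="openin X"])
  next
    fix \<K> assume K: "\<forall>S\<in>\<K>. ?L S"
    then show "\<Union>\<K> \<subseteq> f ` topspace X" by blast
    have "openin X (\<Union>S\<in>\<K>. {x \<in> topspace X. f x \<in> S})"
      using K by blast
    also have "(\<Union>S\<in>\<K>. {x \<in> topspace X. f x \<in> S}) = {x \<in> topspace X. f x \<in> \<Union>\<K>}"
      by blast
    finally show "openin X {x \<in> topspace X. f x \<in> \<Union>\<K>}" .
  qed
  then show ?thesis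
    by (simp add: quotient_topology_def)
qed

lemma topspace_quotient_topology [simp]: "topspace (quotient_topology X f) = f ` topspace X"
proof
  show "topspace (quotient_topology X f) \<subseteq> f ` topspace X"
    using openin_topspace[of "quotient_topology X f"] unfolding openin_quotient_topology by blast
  have "{x \<in> topspace X. f x \<in> f ` topspace X} = topspace X"
    by blast
  then show "f ` topspace X \<subseteq> topspace (quotient_topology X f)"
    by (intro openin_subset) (simp add: openin_quotient_topology)
qed

lemma quotient_map_quotient_topology: "quotient_map X (quotient_topology X f) f"
  by (auto simp: quotient_map_def openin_quotient_topology)

section \<open>The compact-open topology on loops\<close>

lemma topspace_loop_space: "topspace (loop_space Y y) = loops Y y"
proof -
  \<comment> \<open>The empty compact set makes the set of all loops a subbasic open set.\<close>
  have "loops Y y = {g \<in> loops Y y. g ` {} \<subseteq> {}}"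
    by simp
  then show ?thesis
    unfolding loop_space_def topology_generated_by_topspace by fastforce
qed

text \<open>Neighbourhoods in the compact-open topology contain gauge neighbourhoods, which are
  tailored to Bolzano's lemma.\<close>

lemma loop_space_gauge:
  assumes "openin (loop_space Y y) W" "\<delta> \<in> W"
  shows "\<exists>V \<epsilon>. (\<forall>t\<in>{0..1}. openin Y (V t) \<and> \<delta> t \<in> V t \<and> \<epsilon> t > (0::real)) \<and>
    (\<forall>\<beta>\<in>loops Y y. (\<forall>s\<in>{0..1}. \<exists>t\<in>{0..1}. \<bar>s - t\<bar> < \<epsilon> t \<and> \<beta> s \<in> V t) \<longrightarrow> \<beta> \<in> W)"
proof -
  let ?S = "{{g \<in> loops Y y. g ` K \<subseteq> U} | K U.
        compactin (subtopology euclideanreal {0..1}) K \<and> openin Y U}"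
  have "generate_topology_on ?S W"
    using assms(1) by (simp add: loop_space_def openin_topology_generated_by_iff)
  then show ?thesis
    using assms(2)
  proof (induction arbitrary: \<delta>)
    case Empty
    then show ?case by simp
  next
    case (Int a b)
    obtain V \<epsilon> where V: "\<forall>t\<in>{0..1}. openin Y (V t) \<and> \<delta> t \<in> V t \<and> \<epsilon> t > (0::real)"
      "\<And>\<beta>. \<lbrakk>\<beta> \<in> loops Y y; \<forall>s\<in>{0..1}. \<exists>t\<in>{0..1}. \<bar>s - t\<bar> < \<epsilon> t \<and> \<beta> s \<in> V t\<rbrakk> \<Longrightarrow> \<beta> \<in> a"
      using Int.IH(1)[of \<delta>] Int.prems by blast
    obtain V' \<epsilon>' where V': "\<forall>t\<in>{0..1}. openin Y (V' t) \<and> \<delta> t \<in> V' t \<and> \<epsilon>' t > (0::real)"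
      "\<And>\<beta>. \<lbrakk>\<beta> \<in> loops Y y; \<forall>s\<in>{0..1}. \<exists>t\<in>{0..1}. \<bar>s - t\<bar> < \<epsilon>' t \<and> \<beta> s \<in> V' t\<rbrakk> \<Longrightarrow> \<beta> \<in> b"
      using Int.IH(2)[of \<delta>] Int.prems by blast
    show ?case
    proof (intro exI conjI ballI impI)
      fix t :: real assume "t \<in> {0..1}"
      then show "openin Y (V t \<inter> V' t)" "\<delta> t \<in> V t \<inter> V' t" "min (\<epsilon> t) (\<epsilon>' t) > 0"
        using V(1) V'(1) by auto
    next
      fix \<beta> assume b: "\<beta> \<in> loops Y y"
        "\<forall>s\<in>{0..1}. \<exists>t\<in>{0..1}. \<bar>s - t\<bar> < min (\<epsilon> t) (\<epsilon>' t) \<and> \<beta> s \<in> V t \<inter> V' t"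
      have "\<beta> \<in> a"
        by (rule V(2)[OF b(1)]) (use b(2) in \<open>unfold min_less_iff_conj Int_iff, blast\<close>)
      moreover have "\<beta> \<in> b"
        by (rule V'(2)[OF b(1)]) (use b(2) in \<open>unfold min_less_iff_conj Int_iff, blast\<close>)
      ultimately show "\<beta> \<in> a \<inter> b" by simp
    qed
  next
    case (UN K)
    then obtain k where k: "k \<in> K" "\<delta> \<in> k" by blast
    obtain V \<epsilon> where V: "\<forall>t\<in>{0..1}. openin Y (V t) \<and> \<delta> t \<in> V t \<and> \<epsilon> t > (0::real)"
      "\<And>\<beta>. \<lbrakk>\<beta> \<in> loops Y y; \<forall>s\<in>{0..1}. \<exists>t\<in>{0..1}. \<bar>s - t\<bar> < \<epsilon> t \<and> \<beta> s \<in> V t\<rbrakk> \<Longrightarrow> \<beta> \<in> k"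
      using UN.IH[OF k] by blast
    show ?case
      by (rule exI[of _ V], rule exI[of _ \<epsilon>], rule conjI[OF V(1)]) (use V(2) k(1) in blast)
  next
    case (Basis S)
    then obtain K U where KU: "S = {g \<in> loops Y y. g ` K \<subseteq> U}" "compactin (top_of_set {0..1::real}) K" "openin Y U"
      by blast
    then have K: "compact K" "K \<subseteq> {0..1}"
      by (auto simp: compactin_subtopology)
    have \<delta>: "\<delta> ` K \<subseteq> U" "pathin Y \<delta>"
      using Basis KU by (auto simp: loops_def)
    \<comment> \<open>Outside \<open>K\<close> the gauge is at most the distance to
      \<open>K\<close>, so a tag near a point of \<open>K\<close> must itself lie in
      \<open>K\<close>, where \<open>V t\<close> is \<open>U\<close>. On \<open>K\<close> any
      positive gauge would do; 1 is chosen.\<close>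
    have "\<exists>e>0. \<forall>s\<in>K. e \<le> \<bar>s - t\<bar>" if "t \<notin> K" for t
      using separate_point_closed[of K t] compact_imp_closed[OF K(1)] that
      by (auto simp: dist_real_def abs_minus_commute)
    then obtain e where e: "\<And>t. t \<notin> K \<Longrightarrow> e t > (0::real) \<and> (\<forall>s\<in>K. e t \<le> \<bar>s - t\<bar>)"
      by metis
    show ?case
    proof (intro exI conjI ballI impI)
      fix t :: real assume t: "t \<in> {0..1}"
      then have "\<delta> t \<in> topspace Y"
        using path_image_subset_topspace[OF \<delta>(2)] by blast
      then show "openin Y (if t \<in> K then U else topspace Y)" "\<delta> t \<in> (if t \<in> K then U else topspace Y)"
        "0 < (if t \<in> K then 1 else e t)"
        using \<delta> KU(3) e[of t] by auto
    next
      fix \<beta> assume b: "\<beta> \<in> loops Y y"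
        "\<forall>s\<in>{0..1}. \<exists>t\<in>{0..1}. \<bar>s - t\<bar> < (if t \<in> K then 1 else e t) \<and> \<beta> s \<in> (if t \<in> K then U else topspace Y)"
      have "\<beta> s \<in> U" if s: "s \<in> K" for s
      proof -
        obtain t where t: "\<bar>s - t\<bar> < (if t \<in> K then 1 else e t)" "\<beta> s \<in> (if t \<in> K then U else topspace Y)"
          using b(2) K(2) s by blast
        have "t \<in> K"
          using t(1) e[of t] s by (auto split: if_splits)
        then show ?thesis using t(2) by simp
      qed
      then show "\<beta> \<in> S"
        using b(1) KU(1) by blast
    qed
  qed
qed

text \<open>\<open>So\<close> and \<open>Sc\<close> are the images of the open and of the closed collapsed sets; \<open>c\<close> is a (discontinuous)
  section of \<open>p\<close>, used to fix the end points of lifts.\<close>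

locale collapsing_map =
  fixes X :: "'a topology" and Y :: "'b topology" and p :: "'a \<Rightarrow> 'b"
    and So Sc :: "'b set" and c :: "'b \<Rightarrow> 'a"
  assumes quotient: "quotient_map X Y p"
    and finite_So: "finite So"
    and open_So: "\<And>y. y \<in> So \<Longrightarrow> openin Y {y}"
    and path_connected_fibre: "\<And>y. y \<in> So \<Longrightarrow>
          path_connectedin X (X closure_of {x \<in> topspace X. p x = y})"
    and closed_Sc: "closedin Y Sc"
    and local_Sc: "\<And>y V. y \<in> Sc \<Longrightarrow> openin Y V \<Longrightarrow> y \<in> V \<Longrightarrow>
          \<exists>V'. openin Y V' \<and> y \<in> V' \<and> (\<forall>x\<in>topspace X. p x \<in> V' \<longrightarrow>
             path_component_of (subtopology X {x \<in> topspace X. p x \<in> V}) x (c y))"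
    and inj: "\<And>x x'. x \<in> topspace X \<Longrightarrow> x' \<in> topspace X \<Longrightarrow> p x = p x' \<Longrightarrow>
          p x \<notin> So \<union> Sc \<Longrightarrow> x = x'"
    and right_inverse: "\<And>y. y \<in> topspace Y \<Longrightarrow> c y \<in> topspace X \<and> p (c y) = y"
begin

lemma continuous_p: "continuous_map X Y p"
  by (rule quotient_imp_continuous_map[OF quotient])

lemma p_in_topspace: "x \<in> topspace X \<Longrightarrow> p x \<in> topspace Y"
  using continuous_map_image_subset_topspace[OF continuous_p] by blast

text \<open>An open \<open>G\<close> is made saturated by deleting the closed part over
  \<open>Sc\<close> and adding the open fibres over \<open>S\<close>. Off the collapsed points
  \<open>c (p x) = x\<close>, so the condition on \<open>c z\<close> reads off \<open>G\<close>
  itself; over \<open>So\<close>, where \<open>c\<close> is an arbitrary choice, the third premise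
  forces every fibre that meets \<open>G\<close> to be added whole.\<close>

lemma openin_saturation:
  assumes "openin X G" "S \<subseteq> So" "\<And>x. x \<in> G \<Longrightarrow> p x \<in> So \<Longrightarrow> p x \<in> S"
  shows "openin Y {z \<in> topspace Y. z \<notin> Sc \<and> (z \<in> S \<or> c z \<in> G)}" (is "openin Y ?U")
proof -
  have "openin Y (\<Union>z\<in>S. {z})"
    using assms(2) open_So by blast
  then have S: "openin X {x \<in> topspace X. p x \<in> S}"
    using openin_continuous_map_preimage[OF continuous_p] by simp
  have C: "closedin X {x \<in> topspace X. p x \<in> Sc}"
    using closedin_continuous_map_preimage[OF continuous_p closed_Sc] .
  have "{x \<in> topspace X. p x \<in> ?U} = (G \<union> {x \<in> topspace X. p x \<in> S}) - {x \<in> topspace X. p x \<in> Sc}"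
    (is "?L = ?R")
  proof (intro equalityI subsetI)
    have sec: "c (p x) \<in> topspace X" "p (c (p x)) = p x" if "x \<in> topspace X" for x
      using right_inverse[OF p_in_topspace[OF that]] by simp_all
    show "x \<in> ?R" if "x \<in> ?L" for x
    proof (cases "p x \<in> So")
      case True
      then show ?thesis using that assms sec by fastforce
    next
      case False
      then have "c (p x) = x"
        using that sec inj[of "c (p x)" x] by auto
      then show ?thesis using that by auto
    qed
    show "x \<in> ?L" if x: "x \<in> ?R" for x
    proof -
      have xt: "x \<in> topspace X" using x openin_subset[OF assms(1)] by blast
      then have px: "p x \<in> topspace Y" by (rule p_in_topspace)
      show ?thesis
      proof (cases "p x \<in> So")
        case True
        then show ?thesis using x xt px assms by auto
      next
        case False
        then have "c (p x) = x"
          using x xt sec inj[of "c (p x)" x] by auto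
        then show ?thesis using x xt px by auto
      qed
    qed
  qed
  moreover have "openin X ?R"
    using assms(1) S C by blast
  ultimately have "openin X {x \<in> topspace X. p x \<in> ?U}"
    by (rule ssubst)
  moreover have "?U \<subseteq> topspace Y"
    by blast
  ultimately show ?thesis
    using quotient unfolding quotient_map_def by blast
qed

text \<open>The section is a mere choice only over collapsed points. Away from them,
  \<open>openin_saturation\<close> with \<open>S = So\<close> yields the open set of
  \<open>Y\<close> whose preimage under \<open>f\<close> is that of \<open>G\<close> under
  \<open>c \<circ> f\<close>.\<close>

lemma continuous_map_section:
  assumes f: "continuous_map Z Y f" "f ` topspace Z \<inter> (So \<union> Sc) = {}"
  shows "continuous_map Z X (c \<circ> f)"
  unfolding continuous_map
proof (intro conjI allI impI)
  have top: "f z \<in> topspace Y" if "z \<in> topspace Z" for z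
    using that continuous_map_image_subset_topspace[OF f(1)] by blast
  then show "(c \<circ> f) ` topspace Z \<subseteq> topspace X"
    using right_inverse by auto
  fix G assume G: "openin X G"
  let ?U = "{z \<in> topspace Y. z \<notin> Sc \<and> (z \<in> So \<or> c z \<in> G)}"
  have "openin Y ?U"
    by (rule openin_saturation[OF G]) auto
  then have "openin Z {z \<in> topspace Z. f z \<in> ?U}"
    by (rule openin_continuous_map_preimage[OF f(1)])
  also have "{z \<in> topspace Z. f z \<in> ?U} = {z \<in> topspace Z. (c \<circ> f) z \<in> G}"
    using top f(2) by auto
  finally show "openin Z {z \<in> topspace Z. (c \<circ> f) z \<in> G}" .
qed

text \<open>Otherwise the complement of the closure of the fibre, saturated with
  \<open>So - {y}\<close>, would give a neighbourhood of \<open>z\<close> that misses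
  \<open>y\<close>. For \<open>z\<close> in \<open>So\<close> the set \<open>{z}\<close> is itself
  open, so \<open>z = y\<close>.\<close>

lemma section_in_closure_fibre:
  assumes y: "y \<in> So" and z: "z \<in> Y closure_of {y}" "z \<notin> Sc"
  shows "c z \<in> X closure_of {x \<in> topspace X. p x = y}"
proof (cases "z \<in> So")
  case True
  then have "z = y"
    using z(1) open_So by (auto simp: in_closure_of)
  then have "c z \<in> {x \<in> topspace X. p x = y}"
    using z(1) right_inverse by (auto simp: in_closure_of)
  then show ?thesis
    using closure_of_subset[of "{x \<in> topspace X. p x = y}" X] by blast
next
  case False
  have zt: "z \<in> topspace Y"
    using z(1) by (simp add: in_closure_of)
  have imp: "y \<in> T" if "z \<in> T" "openin Y T" for T
    using z(1) that by (simp add: in_closure_of)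
  let ?F = "{x \<in> topspace X. p x = y}"
  let ?U = "{z' \<in> topspace Y. z' \<notin> Sc \<and> (z' \<in> So - {y} \<or> c z' \<in> topspace X - X closure_of ?F)}"
  show ?thesis
  proof (rule ccontr)
    assume n: "c z \<notin> X closure_of ?F"
    have "openin Y ?U"
    proof (rule openin_saturation)
      show "p x \<in> So - {y}" if "x \<in> topspace X - X closure_of ?F" "p x \<in> So" for x
        using that closure_of_subset[of ?F X] by auto
    qed auto
    moreover have "z \<in> ?U"
      using n z(2) zt right_inverse[OF zt] by simp
    ultimately have "y \<in> ?U"
      by (intro imp)
    then have "c y \<notin> X closure_of ?F" and "y \<in> topspace Y" by auto
    then show False
      using right_inverse[of y] closure_of_subset[of ?F X] by auto
  qed
qed

section \<open>Paths that lift up to homotopy\<close>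

text \<open>Here \<open>\<beta>\<close> is the approximation and \<open>\<gamma>\<close> the lift,
  tied only by a homotopy, so \<open>P\<close> constrains \<open>\<beta>\<close> and not
  \<open>p \<circ> \<gamma>\<close>. The ends of \<open>\<gamma>\<close> are fixed by
  \<open>c\<close> so that adjacent lifts fit together. \<open>P\<close> takes the parameter because
  a gauge neighbourhood varies along the path.\<close>

definition lifts :: "(real \<Rightarrow> 'b \<Rightarrow> bool) \<Rightarrow> real \<Rightarrow> real \<Rightarrow> 'b \<Rightarrow> 'b \<Rightarrow> bool" where
  "lifts P u v y z \<longleftrightarrow> (\<exists>\<beta> \<gamma>. continuous_map (top_of_set {u..v}) X \<gamma> \<and> \<gamma> u = c y \<and> \<gamma> v = c z \<and>
     \<beta> u = y \<and> \<beta> v = z \<and> path_homotopic u v Y \<beta> (p \<circ> \<gamma>) \<and> (\<forall>s\<in>{u..v}. P s (\<beta> s)))"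

lemma liftsI:
  assumes "continuous_map (top_of_set {u..v}) X \<gamma>" "\<gamma> u = c y" "\<gamma> v = c z" "\<beta> u = y" "\<beta> v = z"
    "path_homotopic u v Y \<beta> (p \<circ> \<gamma>)" "\<And>s. s \<in> {u..v} \<Longrightarrow> P s (\<beta> s)"
  shows "lifts P u v y z"
  unfolding lifts_def by (intro exI[of _ \<beta>] exI[of _ \<gamma>] conjI ballI assms)

lemma liftsE:
  assumes "lifts P u v y z"
  obtains \<beta> \<gamma> where "continuous_map (top_of_set {u..v}) X \<gamma>" "\<gamma> u = c y" "\<gamma> v = c z"
    "\<beta> u = y" "\<beta> v = z" "path_homotopic u v Y \<beta> (p \<circ> \<gamma>)" "\<And>s. s \<in> {u..v} \<Longrightarrow> P s (\<beta> s)"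
proof -
  from assms[unfolded lifts_def] show thesis
    by (elim exE conjE) (rule that, (assumption | erule (1) bspec)+)
qed

lemma lifts_mono:
  assumes "lifts P u v y z" "\<And>s w. s \<in> {u..v} \<Longrightarrow> P s w \<Longrightarrow> Q s w"
  shows "lifts Q u v y z"
proof -
  obtain \<beta> \<gamma> where L: "continuous_map (top_of_set {u..v}) X \<gamma>" "\<gamma> u = c y" "\<gamma> v = c z"
    "\<beta> u = y" "\<beta> v = z" "path_homotopic u v Y \<beta> (p \<circ> \<gamma>)" "\<And>s. s \<in> {u..v} \<Longrightarrow> P s (\<beta> s)"
    using assms(1) by (rule liftsE) (rule that)
  show ?thesis
    by (rule liftsI[OF L(1-6) assms(2)]) (use L(7) in auto)
qed

lemma lifts_join:
  assumes "lifts P u v x y" "lifts P v w y z" and le: "u \<le> v" "v \<le> w"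
  shows "lifts P u w x z"
proof -
  obtain \<beta> \<gamma> where L: "continuous_map (top_of_set {u..v}) X \<gamma>" "\<gamma> u = c x" "\<gamma> v = c y"
    "\<beta> u = x" "\<beta> v = y" "path_homotopic u v Y \<beta> (p \<circ> \<gamma>)" "\<And>s. s \<in> {u..v} \<Longrightarrow> P s (\<beta> s)"
    using assms(1) by (rule liftsE) (rule that)
  obtain \<beta>' \<gamma>' where R: "continuous_map (top_of_set {v..w}) X \<gamma>'" "\<gamma>' v = c y" "\<gamma>' w = c z"
    "\<beta>' v = y" "\<beta>' w = z" "path_homotopic v w Y \<beta>' (p \<circ> \<gamma>')" "\<And>s. s \<in> {v..w} \<Longrightarrow> P s (\<beta>' s)"
    using assms(2) by (rule liftsE) (rule that)
  show ?thesis
  proof (rule liftsI)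
    show "continuous_map (top_of_set {u..w}) X (\<lambda>s. if s \<le> v then \<gamma> s else \<gamma>' s)"
      by (rule continuous_map_join) (use L R in auto)
    have "path_homotopic u w Y (\<lambda>s. if s \<le> v then \<beta> s else \<beta>' s)
        (\<lambda>s. if s \<le> v then (p \<circ> \<gamma>) s else (p \<circ> \<gamma>') s)"
      by (rule path_homotopic_join[OF L(6) R(6) _ le]) (use L R in simp)
    then show "path_homotopic u w Y (\<lambda>s. if s \<le> v then \<beta> s else \<beta>' s)
        (p \<circ> (\<lambda>s. if s \<le> v then \<gamma> s else \<gamma>' s))"
      by (simp add: o_def if_distrib[of p] cong: if_cong)
  qed (use L R le in \<open>auto split: if_splits\<close>)
qed

lemma lifts_affine:
  assumes "lifts (\<lambda>_. P) 0 1 y z" "u < v"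
  shows "lifts (\<lambda>_. P) u v y z"
proof -
  obtain \<beta> \<gamma> where L: "continuous_map (top_of_set {0..1}) X \<gamma>" "\<gamma> 0 = c y" "\<gamma> 1 = c z"
    "\<beta> 0 = y" "\<beta> 1 = z" "path_homotopic 0 1 Y \<beta> (p \<circ> \<gamma>)" "\<And>s. s \<in> {0..1} \<Longrightarrow> P (\<beta> s)"
    using assms(1) by (rule liftsE) (rule that)
  let ?\<phi> = "\<lambda>s. (s - u) / (v - u)"
  have \<phi>: "continuous_on {u..v} ?\<phi>" "?\<phi> ` {u..v} \<subseteq> {0..1}"
    using assms(2) by (auto intro!: continuous_intros)
  show ?thesis
  proof (rule liftsI[of _ _ "\<gamma> \<circ> ?\<phi>" _ _ "\<beta> \<circ> ?\<phi>"])
    show "continuous_map (top_of_set {u..v}) X (\<gamma> \<circ> ?\<phi>)"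
      by (rule continuous_map_compose[OF _ L(1)]) (use \<phi> in auto)
    show "path_homotopic u v Y (\<beta> \<circ> ?\<phi>) (p \<circ> (\<gamma> \<circ> ?\<phi>))"
      using path_homotopic_compose_right[OF L(6) \<phi>] assms(2) by (simp add: comp_assoc)
    show "P ((\<beta> \<circ> ?\<phi>) s)" if "s \<in> {u..v}" for s
      using \<phi>(2) that L(7) by (simp add: image_subset_iff)
  qed (use L assms(2) in simp_all)
qed

lemma lifts_sym:
  assumes "lifts (\<lambda>_. P) 0 1 y z"
  shows "lifts (\<lambda>_. P) 0 1 z y"
proof -
  obtain \<beta> \<gamma> where L: "continuous_map (top_of_set {0..1}) X \<gamma>" "\<gamma> 0 = c y" "\<gamma> 1 = c z"
    "\<beta> 0 = y" "\<beta> 1 = z" "path_homotopic 0 1 Y \<beta> (p \<circ> \<gamma>)" "\<And>s. s \<in> {0..1} \<Longrightarrow> P (\<beta> s)"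
    using assms(1) by (rule liftsE) (rule that)
  let ?\<phi> = "\<lambda>s. 1 - s :: real"
  have \<phi>: "continuous_on {0..1} ?\<phi>" "?\<phi> ` {0..1} \<subseteq> {0..1}"
    by (auto intro!: continuous_intros)
  show ?thesis
  proof (rule liftsI[of _ _ "\<gamma> \<circ> ?\<phi>" _ _ "\<beta> \<circ> ?\<phi>"])
    show "continuous_map (top_of_set {0..1}) X (\<gamma> \<circ> ?\<phi>)"
      by (rule continuous_map_compose[OF _ L(1)]) (use \<phi> in auto)
    show "path_homotopic 0 1 Y (\<beta> \<circ> ?\<phi>) (p \<circ> (\<gamma> \<circ> ?\<phi>))"
      using path_homotopic_compose_right[OF L(6) \<phi>] by (simp add: comp_assoc)
    show "P ((\<beta> \<circ> ?\<phi>) s)" if "s \<in> {0..1}" for s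
      using that L(7) by simp
  qed (use L in simp_all)
qed

lemma lifts_trans:
  assumes "lifts (\<lambda>_. P) 0 1 x y" "lifts (\<lambda>_. P) 0 1 y z"
  shows "lifts (\<lambda>_. P) 0 1 x z"
  using lifts_join[OF lifts_affine[OF assms(1), of 0 "1/2"] lifts_affine[OF assms(2), of "1/2" 1]]
  by simp

lemma lifts_const:
  assumes "y \<in> topspace Y" "P y"
  shows "lifts (\<lambda>_. P) u v y y"
  by (rule liftsI[of _ _ "\<lambda>_. c y" _ _ "\<lambda>_. y"])
    (use assms right_inverse in \<open>auto simp: o_def path_homotopic_refl\<close>)

lemma lifts_path:
  assumes "pathin X \<gamma>" "\<gamma> 0 = c y" "\<gamma> 1 = c z" "y \<in> topspace Y" "z \<in> topspace Y"
    "\<And>s. s \<in> {0..1} \<Longrightarrow> P (p (\<gamma> s))"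
  shows "lifts (\<lambda>_. P) 0 1 y z"
proof (rule liftsI)
  show "path_homotopic 0 1 Y (p \<circ> \<gamma>) (p \<circ> \<gamma>)"
    using assms(1) continuous_p by (intro path_homotopic_refl continuous_map_compose) (auto simp: pathin_def)
qed (use assms right_inverse in \<open>auto simp: pathin_def\<close>)

text \<open>The path that jumps from \<open>z\<close> to \<open>y\<close> immediately after time 0
  is continuous, as every neighbourhood of \<open>z\<close> contains \<open>y\<close>, and its only
  values \<open>z\<close> and \<open>y\<close> satisfy \<open>P\<close>. The lift moves through the
  path connected closure of the fibre; its image lies in the closure of \<open>{y}\<close>, where
  paths with common ends are homotopic.\<close>

lemma lifts_closure_So:
  assumes y: "y \<in> So" "P y" and z: "z \<in> Y closure_of {y}" "z \<notin> Sc" "P z"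
  shows "lifts (\<lambda>_. P) 0 1 z y"
proof -
  let ?F = "{x \<in> topspace X. p x = y}"
  have zt: "z \<in> topspace Y" and imp: "\<And>T. z \<in> T \<Longrightarrow> openin Y T \<Longrightarrow> y \<in> T"
    using z(1) by (simp_all add: in_closure_of)
  have yt: "y \<in> topspace Y"
    using openin_subset[OF open_So[OF y(1)]] by simp
  have "c y \<in> X closure_of ?F"
    using closure_of_subset[of ?F X] right_inverse[OF yt] by auto
  moreover have "c z \<in> X closure_of ?F"
    by (rule section_in_closure_fibre[OF y(1) z(1,2)])
  ultimately obtain \<gamma> where \<gamma>: "pathin X \<gamma>" "\<gamma> \<in> {0..1} \<rightarrow> X closure_of ?F" "\<gamma> 0 = c z" "\<gamma> 1 = c y"
    using path_connected_fibre[OF y(1)] unfolding path_connectedin by blast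
  let ?\<beta> = "\<lambda>s::real. if s = 0 then z else y"
  show ?thesis
  proof (rule liftsI[of _ _ \<gamma> _ _ ?\<beta>])
    show "path_homotopic 0 1 Y ?\<beta> (p \<circ> \<gamma>)"
    proof (rule path_homotopic_closure_of_singleton[where y=y])
      show "continuous_map (top_of_set {0..1}) Y ?\<beta>"
        unfolding continuous_map
      proof (intro conjI allI impI)
        fix V assume V: "openin Y V"
        have "{s \<in> topspace (top_of_set {0..1}). ?\<beta> s \<in> V} =
            (if z \<in> V then {0..1} else if y \<in> V then {0..1} \<inter> {0<..} else {})"
          using imp[OF _ V] by auto
        then show "openin (top_of_set {0..1}) {s \<in> topspace (top_of_set {0..1}). ?\<beta> s \<in> V}"
          by (simp add: openin_open_Int)
      qed (use yt zt in auto)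
      show "?\<beta> ` {0..1} \<subseteq> Y closure_of {y}"
        using z(1) closure_of_subset[of "{y}" Y] yt by auto
      show "continuous_map (top_of_set {0..1}) Y (p \<circ> \<gamma>)"
        using \<gamma>(1) continuous_p unfolding pathin_def by (rule continuous_map_compose)
      have "p ` (X closure_of ?F) \<subseteq> Y closure_of (p ` ?F)"
        using continuous_p by (rule continuous_map_image_closure_subset)
      also have "\<dots> \<subseteq> Y closure_of {y}"
        by (rule closure_of_mono) auto
      finally show "(p \<circ> \<gamma>) ` {0..1} \<subseteq> Y closure_of {y}"
        using \<gamma>(2) by auto
    qed (use \<gamma> yt zt right_inverse in auto)
  qed (use \<gamma> y z in \<open>auto simp: pathin_def\<close>)
qed

end

section \<open>Approximating a path by paths that lift: local step and patching\<close>

lemma pathin_eventually_in: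
  assumes "pathin Y \<delta>" "t \<in> {0..1}" "openin Y N" "\<delta> t \<in> N"
  obtains d where "d > 0" "\<And>s. s \<in> {0..1} \<Longrightarrow> \<bar>s - t\<bar> < d \<Longrightarrow> \<delta> s \<in> N"
proof -
  have "openin (top_of_set {0..1}) {s \<in> topspace (top_of_set {0..1}). \<delta> s \<in> N}"
    using assms(1,3) unfolding pathin_def by (rule openin_continuous_map_preimage)
  moreover have "t \<in> {s \<in> topspace (top_of_set {0..1}). \<delta> s \<in> N}"
    using assms by simp
  ultimately obtain d where "d > 0" "ball t d \<inter> {0..1} \<subseteq> {s \<in> topspace (top_of_set {0..1}). \<delta> s \<in> N}"
    unfolding openin_contains_ball by blast
  then show thesis
    by (intro that[of d]) (auto simp: dist_real_def abs_minus_commute subset_iff)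
qed

context collapsing_map
begin

text \<open>After its last visit to the closures of the open points the path lifts; up to that visit it
  may be replaced by a path through a single open point.\<close>

lemma lifts_along:
  assumes \<delta>: "pathin Y \<delta>" and avoid: "\<And>s. s \<in> {0..1} \<Longrightarrow> \<delta> s \<notin> Sc"
    and P: "\<And>s. s \<in> {0..1} \<Longrightarrow> P (\<delta> s)"
    and cl: "\<And>s y. s \<in> {0..1} \<Longrightarrow> y \<in> So \<Longrightarrow> \<delta> s \<in> Y closure_of {y} \<Longrightarrow> \<delta> 0 \<in> Y closure_of {y}"
    and So: "\<And>y. y \<in> So \<Longrightarrow> \<delta> 0 \<in> Y closure_of {y} \<Longrightarrow> P y"
  shows "lifts (\<lambda>_. P) 0 1 (\<delta> 0) (\<delta> 1)"
proof -
  have \<delta>c: "continuous_map (top_of_set {0..1}) Y \<delta>"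
    using \<delta> by (simp add: pathin_def)
  have \<delta>t: "\<delta> s \<in> topspace Y" if "s \<in> {0..1}" for s
    using path_image_subset_topspace[OF \<delta>] that by blast
  \<comment> \<open>A finite union of closures is closed, so the set \<open>T\<close> of visiting
    times is compact and has a last element unless it is empty.\<close>
  define B where "B = (\<Union>y\<in>So. Y closure_of {y})"
  define T where "T = {s \<in> {0..1}. \<delta> s \<in> B}"
  have "closedin Y B"
    unfolding B_def using finite_So by (intro closedin_Union) auto
  then have "closedin (top_of_set {0..1}) {s \<in> topspace (top_of_set {0..1}). \<delta> s \<in> B}"
    by (rule closedin_continuous_map_preimage[OF \<delta>c])
  then have "compact T"
    using closedin_compact[OF compact_Icc] by (simp add: T_def)
  have So_B: "y \<in> B" if "y \<in> So" for y
    unfolding B_def using that closure_of_subset[of "{y}" Y] openin_subset[OF open_So[OF that]] by blast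
  \<comment> \<open>By \<open>cl\<close>, the open point whose closure is visited at time
    \<open>s\<close> also has \<open>\<delta> 0\<close> in its closure; it serves as the stopover
    between the two.\<close>
  have jump: "lifts (\<lambda>_. P) 0 1 (\<delta> 0) (\<delta> s)" if sT: "s \<in> T" for s
  proof -
    obtain y where s: "s \<in> {0..1}" and y: "y \<in> So" "\<delta> s \<in> Y closure_of {y}"
      using sT by (auto simp: T_def B_def)
    have y0: "\<delta> 0 \<in> Y closure_of {y}"
      by (rule cl[OF s y])
    have "P y"
      by (rule So[OF y(1) y0])
    then have "lifts (\<lambda>_. P) 0 1 (\<delta> 0) y" "lifts (\<lambda>_. P) 0 1 (\<delta> s) y"
      using y y0 s avoid P by (auto intro!: lifts_closure_So)
    then show ?thesis
      by (rule lifts_trans[OF _ lifts_sym])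
  qed
  have lift: "lifts (\<lambda>_. P) 0 1 (\<delta> r) (\<delta> 1)"
    if r: "r \<in> {0..1}" and no: "\<And>s. s \<in> {r..1} \<Longrightarrow> \<delta> s \<notin> So" for r
  proof -
    let ?\<phi> = "\<lambda>s. r + s * (1 - r)"
    have \<phi>: "?\<phi> s \<in> {r..1}" if "s \<in> {0..1}" for s
    proof -
      have "s * (1 - r) \<le> 1 * (1 - r)" "0 \<le> s * (1 - r)"
        using that r by (intro mult_right_mono mult_nonneg_nonneg; simp)+
      then show ?thesis by simp
    qed
    then have \<phi>': "?\<phi> s \<in> {0..1}" if "s \<in> {0..1}" for s
      using that r by fastforce
    have c: "continuous_map (top_of_set {0..1}) Y (\<delta> \<circ> ?\<phi>)"
      by (rule continuous_map_compose[OF _ \<delta>c])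
        (use \<phi>' in \<open>auto simp: continuous_map_in_subtopology intro!: continuous_intros\<close>)
    have "pathin X (c \<circ> (\<delta> \<circ> ?\<phi>))"
      unfolding pathin_def
    proof (rule continuous_map_section[OF c])
      show "(\<delta> \<circ> ?\<phi>) ` topspace (top_of_set {0..1}) \<inter> (So \<union> Sc) = {}"
        using no \<phi> \<phi>' avoid by auto
    qed
    then show ?thesis
    proof (rule lifts_path)
      show "P (p ((c \<circ> (\<delta> \<circ> ?\<phi>)) s))" if "s \<in> {0..1}" for s
        using P[OF \<phi>'[OF that]] right_inverse[OF \<delta>t[OF \<phi>'[OF that]]] by simp
    qed (use \<delta>t r in auto)
  qed
  show ?thesis
  proof (cases "T = {}")
    case True
    show ?thesis
      by (rule lift) (use True So_B in \<open>auto simp: T_def\<close>)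
  next
    case False
    then obtain r where r: "r \<in> T" "\<And>s. s \<in> T \<Longrightarrow> s \<le> r"
      using compact_attains_sup[OF \<open>compact T\<close>] by blast
    have r01: "r \<in> {0..1}"
      using r(1) by (simp add: T_def)
    have "lifts (\<lambda>_. P) 0 1 (\<delta> r) (\<delta> 1)" if "r < 1"
    proof (rule lift[OF r01])
      fix s assume s: "s \<in> {r..1}"
      show "\<delta> s \<notin> So"
      proof
        \<comment> \<open>At the last visit \<open>r\<close>, being in \<open>So\<close> would keep
          the path at that open point for a while after \<open>r\<close>, which is a later visit.
          This needs room after \<open>r\<close>, so \<open>r = 1\<close> is left to
          \<open>jump\<close>.\<close>
        assume So: "\<delta> s \<in> So"
        then have "s \<in> T"
          using s r01 So_B by (auto simp: T_def)
        then have "s = r"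
          using r(2) s by force
        have "\<delta> r \<in> {\<delta> s}" using \<open>s = r\<close> by simp
        then obtain d where d: "d > 0" "\<And>q. q \<in> {0..1} \<Longrightarrow> \<bar>q - r\<bar> < d \<Longrightarrow> \<delta> q \<in> {\<delta> s}"
          using pathin_eventually_in[OF \<delta> r01 open_So[OF So]] by auto
        define q where "q = min 1 (r + d / 2)"
        have q: "q \<in> {0..1}" "r < q" "\<bar>q - r\<bar> < d"
          using d(1) r01 \<open>r < 1\<close> by (auto simp: q_def min_def)
        then have "q \<in> T"
          using d(2)[of q] So So_B by (auto simp: T_def)
        then show False using r(2) q(2) by force
      qed
    qed
    then show ?thesis
      using jump[OF r(1)] r01 by (cases "r = 1") (auto intro: lifts_trans[OF jump[OF r(1)]])
  qed
qed

text \<open>Only the end \<open>\<delta> s\<close> is prescribed, not the way to it. At a point of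
  \<open>Sc\<close> the image of a path supplied by \<open>local_Sc\<close> takes the place of
  \<open>\<delta>\<close>; elsewhere \<open>lifts_along\<close> is applied to
  \<open>\<delta>\<close> itself after shrinking \<open>V\<close>.\<close>

lemma lifts_near:
  assumes \<delta>: "pathin Y \<delta>" and t: "t \<in> {0..1}" and V: "openin Y V" "\<delta> t \<in> V"
  obtains d where "d > 0" "\<And>s. s \<in> {0..1} \<Longrightarrow> \<bar>s - t\<bar> < d \<Longrightarrow> lifts (\<lambda>_ w. w \<in> V) 0 1 (\<delta> t) (\<delta> s)"
proof -
  have \<delta>t: "\<delta> s \<in> topspace Y" if "s \<in> {0..1}" for s
    using path_image_subset_topspace[OF \<delta>] that by blast
  show thesis
  proof (cases "\<delta> t \<in> Sc")
    case True
    obtain V' where V': "openin Y V'" "\<delta> t \<in> V'" and joined: "\<And>x. x \<in> topspace X \<Longrightarrow> p x \<in> V' \<Longrightarrow>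
        path_component_of (subtopology X {x \<in> topspace X. p x \<in> V}) x (c (\<delta> t))"
      using local_Sc[OF True V] by blast
    obtain d where d: "d > 0" "\<And>s. s \<in> {0..1} \<Longrightarrow> \<bar>s - t\<bar> < d \<Longrightarrow> \<delta> s \<in> V'"
      using pathin_eventually_in[OF \<delta> t V'] by blast
    show thesis
    proof (rule that[OF d(1)])
      fix s assume s: "s \<in> {0..1}" "\<bar>s - t\<bar> < d"
      have cs: "c (\<delta> s) \<in> topspace X" "p (c (\<delta> s)) \<in> V'"
        using right_inverse[OF \<delta>t[OF s(1)]] d(2)[OF s] by simp_all
      obtain \<gamma> where \<gamma>: "pathin (subtopology X {x \<in> topspace X. p x \<in> V}) \<gamma>"
          "\<gamma> 0 = c (\<delta> s)" "\<gamma> 1 = c (\<delta> t)"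
        using joined[OF cs] unfolding path_component_of_def by blast
      have "lifts (\<lambda>_ w. w \<in> V) 0 1 (\<delta> s) (\<delta> t)"
        by (rule lifts_path[of \<gamma>]) (use \<gamma> \<delta>t s(1) t in \<open>auto simp: pathin_subtopology\<close>)
      then show "lifts (\<lambda>_ w. w \<in> V) 0 1 (\<delta> t) (\<delta> s)"
        by (rule lifts_sym)
    qed
  next
    case False
    \<comment> \<open>Once these closures are deleted, any closure of an open point still met near
      \<open>t\<close> contains \<open>\<delta> t\<close>, which is hypothesis \<open>cl\<close> of
      \<open>lifts_along\<close>.\<close>
    define B where "B = (\<Union>y\<in>{y \<in> So. \<delta> t \<notin> Y closure_of {y}}. Y closure_of {y})"
    have "closedin Y B"
      unfolding B_def using finite_So by (intro closedin_Union) auto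
    then have "openin Y (V - (Sc \<union> B))"
      using V(1) closed_Sc by (intro openin_diff closedin_Un)
    moreover have "\<delta> t \<in> V - (Sc \<union> B)"
      using V(2) False by (auto simp: B_def)
    ultimately obtain d where d: "d > 0" "\<And>s. s \<in> {0..1} \<Longrightarrow> \<bar>s - t\<bar> < d \<Longrightarrow> \<delta> s \<in> V - (Sc \<union> B)"
      using pathin_eventually_in[OF \<delta> t] by blast
    show thesis
    proof (rule that[OF d(1)])
      fix s assume s: "s \<in> {0..1}" "\<bar>s - t\<bar> < d"
      let ?\<phi> = "\<lambda>q. (1 - q) * t + q * s"
      have \<phi>: "?\<phi> q \<in> {0..1}" if "q \<in> {0..1}" for q
        using convexD_alt[of "{0..1}" t s q] that s t by simp
      have near: "\<delta> (?\<phi> q) \<in> V - (Sc \<union> B)" if "q \<in> {0..1}" for q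
      proof (rule d(2)[OF \<phi>[OF that]])
        have "?\<phi> q - t = q * (s - t)" by (simp add: algebra_simps)
        also have "\<bar>\<dots>\<bar> \<le> 1 * \<bar>s - t\<bar>"
          using that unfolding abs_mult by (intro mult_right_mono) auto
        finally show "\<bar>?\<phi> q - t\<bar> < d" using s(2) by simp
      qed
      have "lifts (\<lambda>_ w. w \<in> V) 0 1 ((\<delta> \<circ> ?\<phi>) 0) ((\<delta> \<circ> ?\<phi>) 1)"
      proof (rule lifts_along)
        have "continuous_map (top_of_set {0..1}) (top_of_set {0..1}) ?\<phi>"
          using \<phi> by (auto simp: continuous_map_in_subtopology intro!: continuous_intros)
        then show "pathin Y (\<delta> \<circ> ?\<phi>)"
          using \<delta> unfolding pathin_def by (rule continuous_map_compose)
        show "(\<delta> \<circ> ?\<phi>) q \<notin> Sc" "(\<delta> \<circ> ?\<phi>) q \<in> V" if "q \<in> {0..1}" for q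
          using near[OF that] by simp_all
        show "(\<delta> \<circ> ?\<phi>) 0 \<in> Y closure_of {y}"
          if "q \<in> {0..1}" "y \<in> So" "(\<delta> \<circ> ?\<phi>) q \<in> Y closure_of {y}" for q y
        proof (rule ccontr)
          assume "(\<delta> \<circ> ?\<phi>) 0 \<notin> Y closure_of {y}"
          then have "(\<delta> \<circ> ?\<phi>) q \<in> B"
            using that by (auto simp: B_def)
          then show False using near[OF that(1)] by simp
        qed
        show "y \<in> V" if "y \<in> So" "(\<delta> \<circ> ?\<phi>) 0 \<in> Y closure_of {y}" for y
          using that V by (auto simp: in_closure_of)
      qed
      then show "lifts (\<lambda>_ w. w \<in> V) 0 1 (\<delta> t) (\<delta> s)" by simp
    qed
  qed
qed

text \<open>Bolzano's lemma replaces an explicit subdivision. On a short interval around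
  \<open>x\<close> the approximation goes from \<open>\<delta> u\<close> through
  \<open>\<delta> x\<close> to \<open>\<delta> v\<close> inside \<open>V x\<close>, with
  \<open>x\<close> as the tag of every parameter.\<close>

lemma lifts_gauge:
  assumes \<delta>: "pathin Y \<delta>"
    and V: "\<And>t. t \<in> {0..1} \<Longrightarrow> openin Y (V t) \<and> \<delta> t \<in> V t \<and> \<epsilon> t > (0::real)"
    and ab: "0 \<le> a" "a \<le> b" "b \<le> 1"
  shows "lifts (\<lambda>s w. \<exists>t\<in>{0..1}. \<bar>s - t\<bar> < \<epsilon> t \<and> w \<in> V t) a b (\<delta> a) (\<delta> b)"
proof -
  let ?P = "\<lambda>s w. \<exists>t\<in>{0..1}. \<bar>s - t\<bar> < \<epsilon> t \<and> w \<in> V t"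
  \<comment> \<open>The bounds belong to the predicate because the short intervals in Bolzano's
    lemma are not confined to \<open>{a..b}\<close>.\<close>
  have "0 \<le> a \<and> a \<le> b \<and> b \<le> 1 \<longrightarrow> lifts ?P a b (\<delta> a) (\<delta> b)"
    using ab(2)
  proof (induction rule: Bolzano)
    case (trans u v w)
    then show ?case by (auto intro: lifts_join[where v=v])
  next
    case (local x)
    then have x: "x \<in> {0..1}" using ab by simp
    obtain d where d: "d > 0" "\<And>s. s \<in> {0..1} \<Longrightarrow> \<bar>s - x\<bar> < d \<Longrightarrow> lifts (\<lambda>_ w. w \<in> V x) 0 1 (\<delta> x) (\<delta> s)"
      using lifts_near[OF \<delta> x, of "V x"] V[OF x] by blast
    show ?case
    proof (intro exI[of _ "min d (\<epsilon> x)"] conjI allI impI)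
      show "min d (\<epsilon> x) > 0" using d(1) V[OF x] by simp
      fix u v assume uv: "u \<le> x \<and> x \<le> v \<and> v - u < min d (\<epsilon> x)" "0 \<le> u \<and> u \<le> v \<and> v \<le> 1"
      have "lifts (\<lambda>_ w. w \<in> V x) 0 1 (\<delta> x) (\<delta> u)" "lifts (\<lambda>_ w. w \<in> V x) 0 1 (\<delta> x) (\<delta> v)"
        using uv by (intro d(2); auto)+
      then have "lifts (\<lambda>_ w. w \<in> V x) 0 1 (\<delta> u) (\<delta> v)"
        by (rule lifts_trans[OF lifts_sym])
      then have "lifts (\<lambda>_ w. w \<in> V x) u v (\<delta> u) (\<delta> v)"
      proof (cases "u = v")
        \<comment> \<open>\<open>lifts_affine\<close> needs an interval of positive length; a
          degenerate one carries the constant path.\<close>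
        case True
        have "\<delta> x \<in> topspace Y" using V[OF x] openin_subset by blast
        moreover have "u = x" "v = x"
          using True uv by simp_all
        ultimately show ?thesis
          using V[OF x] lifts_const[of "\<delta> x" "\<lambda>w. w \<in> V x" x x] by simp
      qed (use uv in \<open>auto intro: lifts_affine\<close>)
      then show "lifts ?P u v (\<delta> u) (\<delta> v)"
      proof (rule lifts_mono)
        show "?P s w" if "s \<in> {u..v}" "w \<in> V x" for s w
          using that uv by (intro bexI[OF _ x]) auto
      qed
    qed
  qed
  then show ?thesis using ab by simp
qed


text \<open>Write \<open>g \<simeq> (g \<cdot> h\<^sup>-\<^sup>1) \<cdot> h\<close>. A loop in \<open>W\<close> close to the right-hand side is obtained by replacing
  the first factor by a loop that lifts, hence is null-homotopic; so it is homotopic to \<open>h\<close>.\<close>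

theorem homotopy_saturated_open_is_all:
  assumes X: "simply_connected_space X"
    and W: "openin (loop_space Y y) W"
    and saturated: "\<And>f k. f \<in> W \<Longrightarrow> k \<in> loops Y y \<Longrightarrow> path_homotopic 0 1 Y f k \<Longrightarrow> k \<in> W"
    and g: "g \<in> W" and h: "h \<in> loops Y y"
  shows "h \<in> W"
proof -
  have gl: "g \<in> loops Y y"
    using openin_subset[OF W] g unfolding topspace_loop_space by (rule subsetD)
  have gc: "continuous_map (top_of_set {0..1}) Y g" "g 0 = y" "g 1 = y"
    and hc: "continuous_map (top_of_set {0..1}) Y h" "h 0 = y" "h 1 = y"
    using gl h by (auto simp: loops_def pathin_def)
  have yt: "y \<in> topspace Y"
    using path_start_in_topspace[of Y g] gl by (auto simp: loops_def)
  \<comment> \<open>\<open>g\<close> on the first third, \<open>h\<close> reversed on the second,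
    \<open>h\<close> on the last: \<open>\<bar>3 * s - 2\<bar>\<close> falls from 1 to 0 and rises
    back to 1.\<close>
  let ?\<delta> = "\<lambda>s::real. if s \<le> 1/3 then g (3 * s) else h \<bar>3 * s - 2\<bar>"
  \<comment> \<open>The parameter map equals 1 at both ends of \<open>{1/3..1}\<close>, so it
    deforms to the constant 1.\<close>
  have h1: "path_homotopic (1/3) 1 Y (h \<circ> (\<lambda>s. \<bar>3 * s - 2\<bar>)) (h \<circ> (\<lambda>s. 1))"
    by (rule path_homotopic_reparametrize[OF hc(1)]) (auto intro!: continuous_intros)
  have g1: "path_homotopic 0 (1/3) Y (g \<circ> (\<lambda>s. 3 * s)) (g \<circ> (\<lambda>s. 3 * s))"
    by (intro path_homotopic_refl continuous_map_compose[OF _ gc(1)])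
      (auto simp: continuous_map_in_subtopology intro!: continuous_intros)
  have 1: "path_homotopic 0 1 Y
      (\<lambda>s. if s \<le> 1/3 then (g \<circ> (\<lambda>s. 3 * s)) s else (h \<circ> (\<lambda>s. \<bar>3 * s - 2\<bar>)) s)
      (\<lambda>s. if s \<le> 1/3 then (g \<circ> (\<lambda>s. 3 * s)) s else (h \<circ> (\<lambda>s. 1)) s)"
    by (rule path_homotopic_join[OF g1 h1]) (use gc hc in simp_all)
  have 2: "path_homotopic 0 1 Y (g \<circ> (\<lambda>s. min 1 (3 * s))) (g \<circ> (\<lambda>s. s))"
    by (rule path_homotopic_reparametrize[OF gc(1)]) (auto intro!: continuous_intros)
  have "path_homotopic 0 1 Y ?\<delta> g"
  proof (rule path_homotopic_trans)
    show "path_homotopic 0 1 Y ?\<delta> (g \<circ> (\<lambda>s. min 1 (3 * s)))"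
    proof (rule path_homotopic_cong[OF 1])
      show "(g \<circ> (\<lambda>s. min 1 (3 * s))) s = (if s \<le> 1/3 then (g \<circ> (\<lambda>s. 3 * s)) s else (h \<circ> (\<lambda>s. 1)) s)" for s
        using gc hc by (cases "s \<le> 1/3") (simp_all add: min_absorb1 min_absorb2)
    qed auto
    show "path_homotopic 0 1 Y (g \<circ> (\<lambda>s. min 1 (3 * s))) g"
      by (rule path_homotopic_cong[OF 2]) auto
  qed
  then have \<delta>: "path_homotopic 0 1 Y g ?\<delta>"
    by (rule path_homotopic_sym)
  have \<delta>l: "?\<delta> \<in> loops Y y"
    using path_homotopic_continuous(2)[OF \<delta>] gc hc by (simp add: loops_def pathin_def)
  have \<delta>W: "?\<delta> \<in> W"
    by (rule saturated[OF g \<delta>l \<delta>])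
  obtain V \<epsilon> where V: "\<forall>t\<in>{0..1}. openin Y (V t) \<and> ?\<delta> t \<in> V t \<and> \<epsilon> t > (0::real)"
    and VW: "\<forall>\<beta>\<in>loops Y y. (\<forall>s\<in>{0..1}. \<exists>t\<in>{0..1}. \<bar>s - t\<bar> < \<epsilon> t \<and> \<beta> s \<in> V t) \<longrightarrow> \<beta> \<in> W"
    using loop_space_gauge[OF W \<delta>W] by (elim exE conjE) (rule that)
  let ?P = "\<lambda>s w. \<exists>t\<in>{0..1}. \<bar>s - t\<bar> < \<epsilon> t \<and> w \<in> V t"
  \<comment> \<open>Only \<open>g\<close> followed by the reverse of \<open>h\<close> is
    approximated; the last third stays equal to \<open>h\<close>.\<close>
  have "lifts ?P 0 (2/3) (?\<delta> 0) (?\<delta> (2/3))"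
    by (rule lifts_gauge) (use \<delta>l V in \<open>auto simp: loops_def\<close>)
  then have "lifts ?P 0 (2/3) y y"
    using gc hc by simp
  then obtain \<beta> \<gamma> where \<gamma>: "continuous_map (top_of_set {0..2/3}) X \<gamma>" "\<gamma> 0 = c y" "\<gamma> (2/3) = c y"
    and \<beta>: "\<beta> 0 = y" "\<beta> (2/3) = y" "path_homotopic 0 (2/3) Y \<beta> (p \<circ> \<gamma>)" "\<And>s. s \<in> {0..2/3} \<Longrightarrow> ?P s (\<beta> s)"
    by (rule liftsE) (rule that)
  have ct: "c y \<in> topspace X" "p (c y) = y"
    using right_inverse[OF yt] by simp_all
  \<comment> \<open>Simple connectedness speaks of loops on \<open>{0..1}\<close>, so the lift is
    rescaled and the resulting homotopy brought back to \<open>{0..2/3}\<close>.\<close>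
  have \<gamma>': "\<gamma> \<circ> (\<lambda>s. 2/3 * s) \<in> loops X (c y)"
    unfolding loops_def pathin_def
  proof (intro CollectI conjI continuous_map_compose[OF _ \<gamma>(1)])
    show "continuous_map (top_of_set {0..1}) (top_of_set {0..2/3}) (\<lambda>s::real. 2/3 * s)"
      by (auto simp: continuous_map_in_subtopology intro!: continuous_intros)
  qed (use \<gamma> in auto)
  then have "path_homotopic 0 1 X (\<gamma> \<circ> (\<lambda>s. 2/3 * s)) (\<lambda>s. c y)"
    using X ct(1) loop_homotopic_iff_path_homotopic[of "\<gamma> \<circ> (\<lambda>s. 2/3 * s)" "c y"] \<gamma>
    by (auto simp: simply_connected_space_def)
  then have "path_homotopic 0 (2/3) X ((\<gamma> \<circ> (\<lambda>s. 2/3 * s)) \<circ> (\<lambda>s. 3/2 * s)) ((\<lambda>s. c y) \<circ> (\<lambda>s. 3/2 * s))"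
    by (rule path_homotopic_compose_right) (auto intro!: continuous_intros)
  then have "path_homotopic 0 (2/3) Y (p \<circ> ((\<gamma> \<circ> (\<lambda>s. 2/3 * s)) \<circ> (\<lambda>s. 3/2 * s))) (p \<circ> ((\<lambda>s. c y) \<circ> (\<lambda>s. 3/2 * s)))"
    by (rule path_homotopic_compose_left[OF _ continuous_p])
  then have "path_homotopic 0 (2/3) Y (p \<circ> \<gamma>) (\<lambda>s. y)"
    by (rule path_homotopic_cong) (use ct in auto)
  then have null: "path_homotopic 0 (2/3) Y \<beta> (\<lambda>s. y)"
    by (rule path_homotopic_trans[OF \<beta>(3)])
  let ?h = "h \<circ> (\<lambda>s. 3 * s - 2)" and ?\<beta> = "\<lambda>s. if s \<le> 2/3 then \<beta> s else h (3 * s - 2)"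
  have h2: "path_homotopic (2/3) 1 Y ?h ?h"
    by (intro path_homotopic_refl continuous_map_compose[OF _ hc(1)])
      (auto simp: continuous_map_in_subtopology intro!: continuous_intros)
  have 3: "path_homotopic 0 1 Y (\<lambda>s. if s \<le> 2/3 then \<beta> s else ?h s) (\<lambda>s. if s \<le> 2/3 then y else ?h s)"
    by (rule path_homotopic_join[OF null h2]) (use \<beta> hc in simp_all)
  have 4: "path_homotopic 0 1 Y (h \<circ> (\<lambda>s. max 0 (3 * s - 2))) (h \<circ> (\<lambda>s. s))"
    by (rule path_homotopic_reparametrize[OF hc(1)]) (auto intro!: continuous_intros)
  have \<beta>h: "path_homotopic 0 1 Y ?\<beta> h"
  proof (rule path_homotopic_trans)
    show "path_homotopic 0 1 Y ?\<beta> (h \<circ> (\<lambda>s. max 0 (3 * s - 2)))"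
    proof (rule path_homotopic_cong[OF 3])
      show "(h \<circ> (\<lambda>s. max 0 (3 * s - 2))) s = (if s \<le> 2/3 then y else ?h s)" for s
        using hc by (cases "s \<le> 2/3") (simp_all add: max_absorb1 max_absorb2)
    qed auto
    show "path_homotopic 0 1 Y (h \<circ> (\<lambda>s. max 0 (3 * s - 2))) h"
      by (rule path_homotopic_cong[OF 4]) auto
  qed
  have "?\<beta> \<in> loops Y y"
    using path_homotopic_continuous(1)[OF \<beta>h] \<beta> hc by (simp add: loops_def pathin_def)
  moreover have "\<forall>s\<in>{0..1}. ?P s (?\<beta> s)"
  proof
    fix s :: real assume s: "s \<in> {0..1}"
    show "?P s (?\<beta> s)"
    proof (cases "s \<le> 2/3")
      case True
      then show ?thesis using \<beta>(4)[of s] s by simp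
    next
      case False
      \<comment> \<open>Where nothing was changed, \<open>s\<close> serves as its own tag.\<close>
      then have "?\<beta> s = ?\<delta> s" by simp
      moreover have "?\<delta> s \<in> V s" "\<epsilon> s > 0"
        using V s by blast+
      ultimately show ?thesis
        using s by (intro bexI[of _ s]) simp_all
    qed
  qed
  ultimately have "?\<beta> \<in> W"
    by (rule VW[THEN bspec, THEN mp])
  then show ?thesis
    by (rule saturated[OF _ h \<beta>h])
qed

end

section \<open>Collapsing finitely many sets\<close>

lemma collapse_map_self: "x \<in> collapse_map X n A x"
  by (simp add: collapse_map_def collapse_rel_def)

text \<open>The generating relation is symmetric, so its reflexive transitive closure is an
  equivalence and \<open>collapse_map\<close> sends a point to its class.\<close>

lemma collapse_map_eq_iff: "collapse_map X n A x = collapse_map X n A y \<longleftrightarrow> (x, y) \<in> collapse_rel X n A"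
proof -
  have "sym (collapse_rel X n A)"
    unfolding collapse_rel_def by (rule sym_rtrancl) (auto simp: sym_def)
  moreover have "trans (collapse_rel X n A)"
    unfolding collapse_rel_def by (rule trans_rtrancl)
  ultimately show ?thesis
    using collapse_map_self[of y X n A] unfolding collapse_map_def
    by (auto dest: symD transD)
qed

lemma collapse_map_eqI:
  assumes "i < n" "A i \<subseteq> topspace X" "x \<in> A i" "y \<in> A i"
  shows "collapse_map X n A x = collapse_map X n A y"
  unfolding collapse_map_eq_iff collapse_rel_def using assms by (intro r_into_rtrancl) auto

lemma collapse_map_eq_outside:
  assumes "collapse_map X n A x = collapse_map X n A y" "x \<notin> (\<Union>i<n. A i)"
  shows "y = x"
  using assms(1) unfolding collapse_map_eq_iff collapse_rel_def
  by (induction rule: rtrancl_induct) (use assms(2) in auto)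

text \<open>A chain of identifications inside \<open>A j\<close> can never step out of it, as no
  other collapsed set meets \<open>A j\<close>.\<close>

lemma collapse_map_eq_isolated:
  assumes "collapse_map X n A x = collapse_map X n A y" "x \<in> A j"
    and "\<And>i. i < n \<Longrightarrow> i \<noteq> j \<Longrightarrow> A i \<inter> A j = {}"
  shows "y \<in> A j"
  using assms(1) unfolding collapse_map_eq_iff collapse_rel_def
proof (induction rule: rtrancl_induct)
  case (step y z)
  then show ?case using assms(3) by blast
qed (rule assms(2))

text \<open>Collapsed sets may overlap, so a fibre can be a union of several of them, linked in
  chains. Paths in the closures of the links connect the fibre, and its closure is the finite union
  of those closures.\<close>

lemma path_connectedin_closure_fibre:
  assumes A: "\<And>i. i < n \<Longrightarrow> A i \<subseteq> topspace X \<and> path_connectedin X (X closure_of A i)"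
    and x: "x \<in> A k" "k < n"
  shows "path_connectedin X (X closure_of {z \<in> topspace X. collapse_map X n A z = collapse_map X n A x})"
    (is "path_connectedin X (X closure_of ?F)")
proof -
  let ?p = "collapse_map X n A"
  let ?S = "subtopology X (X closure_of ?F)"
  define M where "M = {i. i < n \<and> (\<exists>z\<in>A i. ?p z = ?p x)}"
  have A_F: "A i \<subseteq> ?F" if "i \<in> M" for i
    using that A collapse_map_eqI[of i n A X] unfolding M_def by blast
  have join: "path_component_of ?S z w" if i: "i \<in> M" and zw: "z \<in> X closure_of A i" "w \<in> X closure_of A i" for i z w
  proof -
    have "i < n" using i by (simp add: M_def)
    then obtain g where g: "pathin X g" "g \<in> {0..1} \<rightarrow> X closure_of A i" "g 0 = z" "g 1 = w"
      using A zw unfolding path_connectedin by blast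
    moreover have "X closure_of A i \<subseteq> X closure_of ?F"
      by (rule closure_of_mono[OF A_F[OF i]])
    ultimately show ?thesis
      unfolding path_component_of_def pathin_subtopology by blast
  qed
  have cl: "A i \<subseteq> X closure_of A i" if "i \<in> M" for i
    using A that by (auto simp: M_def intro!: closure_of_subset)
  have xF: "x \<in> ?F"
    using A x by auto
  have fibre: "path_component_of ?S x z" if "(x, z) \<in> collapse_rel X n A" for z
    using that unfolding collapse_rel_def
  proof (induction rule: rtrancl_induct)
    case base
    then show ?case
      using xF closure_of_subset[of ?F X] by (auto simp: path_component_of_refl)
  next
    case (step z w)
    show ?case
    proof (cases "z = w")
      case False
      then obtain i where i: "i < n" "z \<in> A i" "w \<in> A i"
        using step by blast
      have "?p x = ?p z"
        unfolding collapse_map_eq_iff using step(1) by (simp add: collapse_rel_def)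
      then have "i \<in> M"
        using i by (auto simp: M_def)
      then have "path_component_of ?S z w"
        using i cl by (intro join) auto
      with step.IH show ?thesis
        by (rule path_component_of_trans)
    qed (use step.IH in simp)
  qed
  have "?F \<subseteq> (\<Union>i\<in>M. A i)"
  proof
    fix z assume z: "z \<in> ?F"
    have "z \<in> (\<Union>i<n. A i)"
      using collapse_map_eq_outside[of X n A z x] z x by auto
    then show "z \<in> (\<Union>i\<in>M. A i)"
      using z by (auto simp: M_def)
  qed
  then have "X closure_of ?F \<subseteq> X closure_of (\<Union>i\<in>M. A i)"
    by (rule closure_of_mono)
  also have "\<dots> = (\<Union>i\<in>M. X closure_of A i)"
    by (subst closure_of_Union) (auto simp: M_def)
  finally have F: "X closure_of ?F \<subseteq> (\<Union>i\<in>M. X closure_of A i)" .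
  have from_x: "path_component_of ?S x z" if z: "z \<in> X closure_of ?F" for z
  proof -
    obtain i where i: "i \<in> M" "z \<in> X closure_of A i"
      using F z by blast
    obtain w where w: "w \<in> A i" "?p w = ?p x"
      using i(1) by (auto simp: M_def)
    have "path_component_of ?S x w"
      by (rule fibre) (use w(2) collapse_map_eq_iff in metis)
    moreover have "path_component_of ?S w z"
      using cl[OF i(1)] w(1) i by (intro join) auto
    ultimately show ?thesis
      by (rule path_component_of_trans)
  qed
  have "path_component_of ?S z w" if "z \<in> X closure_of ?F" "w \<in> X closure_of ?F" for z w
    by (rule path_component_of_trans[OF path_component_of_sym[OF from_x[OF that(1)]] from_x[OF that(2)]])
  then show ?thesis
    unfolding path_connectedin_def path_connected_space_def path_component_of_def[symmetric]
    by (auto simp: closure_of_subset_topspace)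
qed

text \<open>\<open>I\<close> lists the sets used as open, \<open>J\<close> those used as closed.
  Open ones may overlap; disjointness of closures isolates the sets in \<open>J\<close>, so that
  \<open>A j\<close> is a full fibre, and local path connectedness then supplies small saturated
  neighbourhoods of it.\<close>

lemma collapsing_map_collapse:
  assumes IJ: "I \<union> J = {..<n}"
    and A: "\<And>i. i < n \<Longrightarrow> A i \<subseteq> topspace X \<and> path_connectedin X (X closure_of A i)"
    and I: "\<And>i. i \<in> I \<Longrightarrow> openin X (A i)"
    and J: "\<And>j. j \<in> J \<Longrightarrow> closedin X (A j)"
    and disj: "\<And>i j. i < n \<Longrightarrow> j \<in> J \<Longrightarrow> i \<noteq> j \<Longrightarrow> X closure_of A i \<inter> X closure_of A j = {}"
    and lpc: "J \<noteq> {} \<Longrightarrow> locally_path_connected_space X"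
  shows "collapsing_map X (collapse_space X n A) (collapse_map X n A)
    (collapse_map X n A ` (\<Union>i\<in>I. A i)) (collapse_map X n A ` (\<Union>j\<in>J. A j))
    (inv_into (topspace X) (collapse_map X n A))"
    (is "collapsing_map X ?Y ?p ?So ?Sc ?c")
proof
  have In: "i < n" if "i \<in> I" for i using IJ that by blast
  have Jn: "j < n" if "j \<in> J" for j using IJ that by blast
  have disjA: "A i \<inter> A j = {}" if "i < n" "j \<in> J" "i \<noteq> j" for i j
    using disj[OF that] closure_of_subset[of "A i" X] closure_of_subset[of "A j" X]
      A[OF that(1)] A[OF Jn[OF that(2)]] by blast
  have fibreJ: "z \<in> A j" if "j \<in> J" "w \<in> A j" "?p w = ?p z" for j w z
    using collapse_map_eq_isolated[OF that(3,2)] disjA that(1) by blast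
  show q: "quotient_map X ?Y ?p"
    unfolding collapse_space_def by (rule quotient_map_quotient_topology)
  then have topY: "topspace ?Y = ?p ` topspace X"
    by (simp add: quotient_map_def)
  have "finite (?p ` A i)" if "i < n" for i
  proof (cases "A i = {}")
    case False
    then obtain x where "x \<in> A i" by blast
    then have "?p ` A i \<subseteq> {?p x}"
      using collapse_map_eqI[of i n A X _ x] A[OF that] that by blast
    then show ?thesis by (rule finite_subset) simp
  qed simp
  moreover have "finite I"
    using IJ by (metis finite_Un finite_lessThan)
  ultimately show "finite ?So"
    unfolding image_UN using In by simp
  show "openin ?Y {y}" if y: "y \<in> ?So" for y
  proof -
    obtain k x where x: "k \<in> I" "x \<in> A k" "y = ?p x"
      using y by blast
    \<comment> \<open>Even when several sets are merged, the fibre is a union of open ones, which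
      makes its image an open point.\<close>
    let ?M = "{i \<in> I. \<exists>z\<in>A i. ?p z = ?p x}"
    have "{z \<in> topspace X. ?p z = ?p x} = (\<Union>i\<in>?M. A i)"
    proof (intro equalityI subsetI)
      fix z assume z: "z \<in> {z \<in> topspace X. ?p z = ?p x}"
      then obtain i where i: "i < n" "z \<in> A i"
        using collapse_map_eq_outside[of X n A z x] x In by auto
      show "z \<in> (\<Union>i\<in>?M. A i)"
      proof (cases "i \<in> J")
        case True
        then have "x \<in> A i"
          using fibreJ[OF True i(2)] z by simp
        then have "i = k"
          using disjA[OF In[OF x(1)] True] x(2) by blast
        then show ?thesis using i z x by blast
      next
        case False
        then show ?thesis using i z IJ by blast
      qed
    next
      fix z assume "z \<in> (\<Union>i\<in>?M. A i)"
      then obtain i w where i: "i \<in> I" "w \<in> A i" "?p w = ?p x" "z \<in> A i" by blast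
      then show "z \<in> {z \<in> topspace X. ?p z = ?p x}"
        using A[OF In] collapse_map_eqI[OF In, of i A X z w] by auto
    qed
    moreover have "openin X (\<Union>i\<in>?M. A i)"
      using I by blast
    ultimately show ?thesis
      using x A[OF In] unfolding collapse_space_def openin_quotient_topology by auto
  qed
  show "path_connectedin X (X closure_of {x \<in> topspace X. ?p x = y})" if y: "y \<in> ?So" for y
  proof -
    obtain k x where x: "k \<in> I" "x \<in> A k" "y = ?p x"
      using y by blast
    show ?thesis
      unfolding x(3) using A x(2) In[OF x(1)] by (rule path_connectedin_closure_fibre)
  qed
  have "{x \<in> topspace X. ?p x \<in> ?Sc} = (\<Union>j\<in>J. A j)"
    using A Jn fibreJ by (auto; metis)
  moreover have "closedin X (\<Union>j\<in>J. A j)"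
    using J IJ by (intro closedin_Union) (auto intro: finite_subset[of _ "{..<n}"])
  ultimately have "closedin X {x \<in> topspace X. ?p x \<in> ?Sc}"
    by (rule ssubst)
  moreover have "?Sc \<subseteq> topspace ?Y"
    unfolding topY using A[OF Jn] by blast
  ultimately show "closedin ?Y ?Sc"
    using q unfolding quotient_map_closedin by blast
  show c: "?c y \<in> topspace X \<and> ?p (?c y) = y" if "y \<in> topspace ?Y" for y
    using that unfolding topY by (simp add: inv_into_into f_inv_into_f)
  show "x = x'" if "x \<in> topspace X" "x' \<in> topspace X" "?p x = ?p x'" "?p x \<notin> ?So \<union> ?Sc" for x x'
  proof -
    have "x \<notin> (\<Union>i<n. A i)"
      using that(4) unfolding IJ[symmetric] by blast
    then show ?thesis
      using collapse_map_eq_outside[OF that(3)] by simp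
  qed
  show "\<exists>V'. openin ?Y V' \<and> y \<in> V' \<and> (\<forall>x\<in>topspace X. ?p x \<in> V' \<longrightarrow>
      path_component_of (subtopology X {x \<in> topspace X. ?p x \<in> V}) x (?c y))"
    if y: "y \<in> ?Sc" and V: "openin ?Y V" "y \<in> V" for y V
  proof -
    obtain j z where z: "j \<in> J" "z \<in> A j" "y = ?p z"
      using y by blast
    have Aj: "A j \<subseteq> topspace X" "X closure_of A j = A j"
      using A Jn[OF z(1)] J[OF z(1)] by (auto simp: closure_of_closedin)
    have yt: "y \<in> topspace ?Y"
      using z Aj unfolding topY by blast
    have cy: "?c y \<in> A j"
      using c[OF yt] z fibreJ[OF z(1,2)] by simp
    \<comment> \<open>\<open>D\<close> lies over \<open>V\<close> and avoids the closures of the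
      other collapsed sets, so \<open>A j\<close> is the only one that a path component of
      \<open>D\<close> can meet.\<close>
    define D where "D = {x \<in> topspace X. ?p x \<in> V} - (\<Union>i\<in>{..<n} - {j}. X closure_of A i)"
    have "openin X {x \<in> topspace X. ?p x \<in> V}"
      using openin_continuous_map_preimage[OF quotient_imp_continuous_map[OF q] V(1)] .
    then have D: "openin X D"
      unfolding D_def by (intro openin_diff closedin_Union) auto
    have AD: "A j \<subseteq> D"
    proof
      fix x assume x: "x \<in> A j"
      then have "?p x = y"
        using collapse_map_eqI[of j n A X x z, OF Jn[OF z(1)] Aj(1) x z(2)] z(3) by simp
      then show "x \<in> D"
        using x Aj disj[OF _ z(1)] V(2) by (auto simp: D_def)
    qed
    \<comment> \<open>This path component is open by local path connectedness, and saturated since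
      it contains all of \<open>A j\<close> and misses the other collapsed sets.\<close>
    define Q where "Q = Collect (path_component_of (subtopology X D) (?c y))"
    have "locally_path_connected_space X"
      using lpc z(1) by blast
    then have "openin (subtopology X D) Q"
      unfolding Q_def using D
      by (intro openin_path_component_of_locally_path_connected_space locally_path_connected_space_open_subset)
    then have Q: "openin X Q"
      using D by (rule openin_trans_full)
    have QD: "Q \<subseteq> D"
      unfolding Q_def using path_component_of_subset_topspace[of "subtopology X D" "?c y"] by auto
    have AQ: "A j \<subseteq> Q"
    proof
      fix x assume x: "x \<in> A j"
      obtain g where "pathin X g" "g \<in> {0..1} \<rightarrow> A j" "g 0 = ?c y" "g 1 = x"
        using A[OF Jn[OF z(1)]] cy x unfolding path_connectedin Aj(2) by blast
      then show "x \<in> Q"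
        using AD unfolding Q_def path_component_of_def pathin_subtopology by blast
    qed
    have sat: "x \<in> Q" if x: "x \<in> topspace X" "?p x \<in> ?p ` Q" for x
    proof -
      obtain w where w: "w \<in> Q" "?p w = ?p x"
        using x(2) by fastforce
      show ?thesis
      proof (cases "w \<in> (\<Union>i<n. A i)")
        case True
        then obtain i where i: "i < n" "w \<in> A i" by blast
        then have "w \<in> X closure_of A i"
          using A[OF i(1)] closure_of_subset[of "A i" X] by blast
        then have "i = j"
          using w(1) QD i(1) by (auto simp: D_def)
        then have "x \<in> A j"
          using fibreJ[OF z(1) _ w(2)] i(2) by simp
        then show ?thesis using AQ by blast
      next
        case False
        then show ?thesis
          using collapse_map_eq_outside[OF w(2)] w(1) by simp
      qed
    qed
    have "{x \<in> topspace X. ?p x \<in> ?p ` Q} = Q"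
      using sat openin_subset[OF Q] by blast
    then have "openin ?Y (?p ` Q)"
      using Q openin_subset[OF Q] unfolding collapse_space_def openin_quotient_topology by auto
    moreover have "y \<in> ?p ` Q"
      using c[OF yt] cy AQ by (metis image_eqI subsetD)
    moreover have "path_component_of (subtopology X {x \<in> topspace X. ?p x \<in> V}) x (?c y)"
      if "x \<in> topspace X" "?p x \<in> ?p ` Q" for x
    proof -
      have "path_component_of (subtopology X D) (?c y) x"
        using sat[OF that] by (simp add: Q_def)
      then have "path_component_of (subtopology X {x \<in> topspace X. ?p x \<in> V}) (?c y) x"
        by (rule path_component_of_mono) (auto simp: D_def)
      then show ?thesis
        by (rule path_component_of_sym)
    qed
    ultimately show ?thesis by blast
  qed
qed

text \<open>The first alternative is the case \<open>J = {}\<close>, where the disjointness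
  condition is vacuous. In the second, a set that is both open and closed is counted as
  open.\<close>

lemma condition_star_collapsing_map:
  assumes "condition_star X n A"
  obtains So Sc c where "collapsing_map X (collapse_space X n A) (collapse_map X n A) So Sc c"
proof -
  consider (i) "\<And>i. i < n \<Longrightarrow> openin X (A i) \<and> path_connectedin X (X closure_of A i)"
    | (ii) "locally_path_connected_space X"
      "\<And>i. i < n \<Longrightarrow> (openin X (A i) \<or> closedin X (A i)) \<and> path_connectedin X (X closure_of A i)"
      "\<And>i j. i < n \<Longrightarrow> j < n \<Longrightarrow> i \<noteq> j \<Longrightarrow> X closure_of A i \<inter> X closure_of A j = {}"
    using assms unfolding condition_star_def by blast
  then show thesis
  proof cases
    case i
    show thesis
      by (rule that, rule collapsing_map_collapse[where I="{..<n}" and J="{}"])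
        (use i openin_subset in auto)
  next
    case ii
    show thesis
    proof (rule that, rule collapsing_map_collapse[where I="{i. i < n \<and> openin X (A i)}"
            and J="{i. i < n \<and> \<not> openin X (A i)}"])
      show "A i \<subseteq> topspace X \<and> path_connectedin X (X closure_of A i)" if "i < n" for i
        using ii(2)[OF that] openin_subset[of X "A i"] closedin_subset[of X "A i"] by blast
    qed (use ii in auto)
  qed
qed

section \<open>Indiscreteness of the fundamental group\<close>

theorem theorem4p1:
  fixes X :: "'a topology" and n :: nat and A :: "nat \<Rightarrow> 'a set" and a :: 'a
  assumes "condition_star X n A"
    and "simply_connected_space X"
    and "a \<in> (\<Union>i<n. A i)"
  shows "\<forall>U. openin (pi1_top (collapse_space X n A) (collapse_map X n A a)) U \<longleftrightarrow>
             U = {} \<or> U = topspace (pi1_top (collapse_space X n A) (collapse_map X n A a))"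
proof (intro allI iffI)
  let ?Y = "collapse_space X n A" and ?y = "collapse_map X n A a"
  obtain So Sc c where "collapsing_map X ?Y (collapse_map X n A) So Sc c"
    using condition_star_collapsing_map[OF assms(1)] .
  then interpret collapsing_map X ?Y "collapse_map X n A" So Sc c .
  fix U
  show "openin (pi1_top ?Y ?y) U" if "U = {} \<or> U = topspace (pi1_top ?Y ?y)"
    using that by auto
  assume U: "openin (pi1_top ?Y ?y) U"
  have U_sub: "U \<subseteq> loop_class ?Y ?y ` loops ?Y ?y"
    and U_open: "openin (loop_space ?Y ?y) {g \<in> loops ?Y ?y. loop_class ?Y ?y g \<in> U}"
    using U unfolding pi1_top_def openin_quotient_topology topspace_loop_space by simp_all
  show "U = {} \<or> U = topspace (pi1_top ?Y ?y)"
  proof (rule disjCI)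
    assume "U \<noteq> topspace (pi1_top ?Y ?y)"
    then obtain h where h: "h \<in> loops ?Y ?y" "loop_class ?Y ?y h \<notin> U"
      using U_sub unfolding pi1_top_def topspace_quotient_topology topspace_loop_space by blast
    show "U = {}"
    proof (rule ccontr)
      assume "U \<noteq> {}"
      then obtain g where g: "g \<in> {g \<in> loops ?Y ?y. loop_class ?Y ?y g \<in> U}"
        using U_sub by blast
      \<comment> \<open>The preimage of \<open>U\<close> is open, closed under homotopy and contains
        \<open>g\<close>, so it contains every loop, even \<open>h\<close>, whose class was chosen
        outside \<open>U\<close>.\<close>
      have "h \<in> {g \<in> loops ?Y ?y. loop_class ?Y ?y g \<in> U}"
        using assms(2) U_open _ g h(1)
      proof (rule homotopy_saturated_open_is_all)
        fix f k
        assume f: "f \<in> {g \<in> loops ?Y ?y. loop_class ?Y ?y g \<in> U}" and k: "k \<in> loops ?Y ?y"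
          and fk: "path_homotopic 0 1 ?Y f k"
        \<comment> \<open>Classes are sets of loops, so they agree once \<open>f\<close> and
          \<open>k\<close> are homotopic to the same loops.\<close>
        have "loop_homotopic ?Y ?y f l \<longleftrightarrow> loop_homotopic ?Y ?y k l" for l
        proof -
          have "path_homotopic 0 1 ?Y f l \<longleftrightarrow> path_homotopic 0 1 ?Y k l"
            using path_homotopic_trans[OF fk, of l] path_homotopic_trans[OF path_homotopic_sym[OF fk], of l]
            by (rule iffI[rotated])
          then show ?thesis
            using f k loop_homotopic_iff_path_homotopic[of f ?y] loop_homotopic_iff_path_homotopic[of k ?y]
            by (simp add: loops_def)
        qed
        then have "loop_class ?Y ?y f = loop_class ?Y ?y k"
          by (simp add: loop_class_def)
        then show "k \<in> {g \<in> loops ?Y ?y. loop_class ?Y ?y g \<in> U}"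
          using f k by simp
      qed
      then show False using h(2) by simp
    qed
  qed
qed

end
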